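(* Let $n\ge 1$ and let $\mathcal{Q}=(Q_0,\dots,Q_n)$ be any block. Let $E$ be an admissible potential, let $\delta_i=\delta(Q_i)$ and let $\epsilon_{ij}=\epsilon(Q_i,Q_j)$. Then $$\mathbf{ERR}(\mathcal{Q})\le\sum_{i=0}^{n-1}\ \sum_{\substack{0\le j\le n\\ j\ne i}}\epsilon_{ij}\,\delta_i^2 .$$ (If $\Psi_{\min}(Q_i,Q_j)=0$ for some pair occurring in the sum, the right-hand side is interpreted as $+\infty$ and nothing is asserted.)
   Context: Stereographic projection: $\Sigma:S^2\to\mathbb{C}\cup\{\infty\}$, $\Sigma(x,y,z)=\frac{x}{1-z}+i\frac{y}{1-z}$, $\Sigma(0,0,1)=\infty$. Distances in $\mathbb{R}^3$ are Euclidean. Dyadic objects: a dyadic square is $[-2,2]^2\subset\mathbb{C}$ or any square obtained from it by finitely many steps, each replacing a square by one of the four squares obtained by halving it in both directions. A dyadic segment is $[0,4]\subset\mathbb{R}$ or any segment obtained from it by repeatedly passing to one of the two halves. A dyadic object is a dyadic square, a dyadic segment, or $\{\infty\}$. A dyadic square is normal if it does not cross the coordinate axes; every dyadic segment (contained in $[0,4]$) is also regarded as normal. Vertices of a segment are its endpoints; the vertex of $\{\infty\}$ is $\infty$. Write $Q^*=\Sigma^{-1}(Q)$. For $Q$ a dyadic square or segment put $\underline{x}=\min_{z\in Q}|x|$, $\overline{x}=\max_{z\in Q}|x|$, $\underline{y}=\min_{z\in Q}|y|$, $\overline{y}=\max_{z\in Q}|y|$ (where $z=x+iy$), $\delta(Q)=\frac{2(\overline{x}-\underline{x})}{1+\underline{x}^2+\underline{y}^2}$,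 and $\tau(Q)=\sqrt{\dim Q}$ (so $1$ for segments and $\sqrt2$ for squares). Put $\delta(\{\infty\})=\tau(\{\infty\})=0$. Separation bound: for dyadic objects $Q,\widehat{Q}$ with centers $z,\widehat{z}$ (the center of $\{\infty\}$ is $\infty$) let $D=\|\Sigma^{-1}(z)-\Sigma^{-1}(\widehat z)\|$, $\delta'=\frac14\big(\delta(Q)\tau(Q)+\delta(\widehat Q)\tau(\widehat Q)\big)$. $\Psi_{\min}(Q,\widehat Q)$ is the maximum of: the number $0$; the number $D(1-\delta'^2/2)-\sqrt{4-D^2}\,\delta'$; and, when $Q$ is normal and $\widehat Q=\{\infty\}$, the minimum of $\|\Sigma^{-1}(v)-(0,0,1)\|$ over vertices $v$ of $Q$. Block: a tuple $(Q_0,\dots,Q_n)$ of dyadic objects with $Q_n=\{\infty\}$ and each of $Q_0,\dots,Q_{n-1}$ a dyadic segment or a dyadic square. A configuration $(z_0,\dots,z_n)$ is dominated by the block if $z_k\in Q_k$ for all $k$; it is a vertex configuration if $z_k$ is a vertex of $Q_k$ for all $k$. Admissible potential: a twice differentiable, convex, decreasing function $E:(0,\infty)\to(0,\infty)$ such that whenever $0<r_2\le r_1$ there are constants $c\ge1$, $h\ge0$ (depending on $r_1,r_2$) with $\frac{E'(r_2)}{r_2}=c\,\frac{E'(r_1)}{r_1}$ and $E''(r_2)=(c+h)E''(r_1)$. (For example $E(r)=r^{-e}$, $e>0$.) Energy: $E(z_0,\dots,z_n)=\sum_{i<j}E\big(\|\Sigma^{-1}(z_i)-\Sigma^{-1}(z_j)\|\big)$.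 $\mathcal{E}(\mathcal{Q})$ is the minimum of the energy over configurations dominated by $\mathcal{Q}$, $\mathcal{E}'(\mathcal{Q})$ is its minimum over vertex configurations, and $\mathbf{ERR}(\mathcal{Q})=\mathcal{E}'(\mathcal{Q})-\mathcal{E}(\mathcal{Q})$. Error terms: with $R=\Psi_{\min}(Q,\widehat Q)>0$, $\epsilon(Q,\widehat Q)=\max(0,\Lambda_1)+\Lambda_2$, where, if $Q$ is a dyadic segment, $$\Lambda_1=\frac{R}{32}E'(R)+\Big(\frac18-\frac{R^2}{32}\Big)E''(R),\qquad \Lambda_2=-\frac{E'(R)}{8},$$ and, if $Q$ is a dyadic square, $$\Lambda_1=\frac{R}{16}E'(R)+\Big(\frac14-\frac{R^2}{16}\Big)E''(R),\qquad \Lambda_2=-\frac{E'(R)}{7.98}\Big(\sqrt{1+\overline{x}^2}+\sqrt{1+\overline{y}^2}\Big),$$ with $\overline{x},\overline{y}$ taken for $Q$. If $R=0$, then $\epsilon(Q,\widehat Q)=+\infty$. *)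

theory Defs
  imports "HOL-Analysis.Analysis"
begin

section \<open>Stereographic projection\<close>

text \<open>Points of the extended plane are of type \<^typ>\<open>complex option\<close>; \<^const>\<open>None\<close> is the point at infinity.\<close>

definition north_pole :: "real^3" where
  "north_pole = vector [0, 0, 1]"

definition stereo :: "real^3 \<Rightarrow> complex option" where
  "stereo p = (if p = north_pole then None
     else Some (Complex (p$1 / (1 - p$3)) (p$2 / (1 - p$3))))"

definition inv_stereo :: "complex option \<Rightarrow> real^3" where
  "inv_stereo = inv_into (sphere 0 1) stereo"

lemma bij_betw_stereo: "bij_betw stereo (sphere 0 1) UNIV"
proof -
  define g :: "complex option \<Rightarrow> real^3" where
    "g = (\<lambda>w. case w of None \<Rightarrow> north_pole | Some z \<Rightarrow>
       vector [2 * Re z / (1 + (cmod z)\<^sup>2), 2 * Im z / (1 + (cmod z)\<^sup>2), 1 - 2 / (1 + (cmod z)\<^sup>2)])"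
  have pos: "1 + (cmod z)\<^sup>2 > 0" for z
    by (simp add: add_pos_nonneg)
  have sph: "p \<in> sphere 0 1 \<longleftrightarrow> (p$1)\<^sup>2 + (p$2)\<^sup>2 + (p$3)\<^sup>2 = 1" for p :: "real^3"
    by (simp add: norm_eq_1 inner_vec_def sum_3 power2_eq_square)
  have ext: "p = q \<longleftrightarrow> p$1 = q$1 \<and> p$2 = q$2 \<and> p$3 = q$3" for p q :: "real^3"
    by (simp add: vec_eq_iff forall_3)
  have np: "north_pole$1 = 0" "north_pole$2 = 0" "north_pole$3 = 1"
    by (simp_all add: north_pole_def)
  have third: "p = north_pole \<longleftrightarrow> p$3 = 1" if "p \<in> sphere 0 1" for p
  proof -
    have "(p$1)\<^sup>2 + (p$2)\<^sup>2 + (p$3)\<^sup>2 = 1" using that by (simp only: sph)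
    then show ?thesis by (auto simp: ext np sum_power2_eq_zero_iff)
  qed
  show ?thesis
  proof (rule bij_betw_byWitness[where f' = g])
    show "\<forall>p\<in>sphere 0 1. g (stereo p) = p"
    proof
      fix p :: "real^3" assume p: "p \<in> sphere 0 1"
      show "g (stereo p) = p"
      proof (cases "p = north_pole")
        case True
        then show ?thesis by (simp add: stereo_def g_def)
      next
        case False
        define z where "z = Complex (p$1 / (1 - p$3)) (p$2 / (1 - p$3))"
        have ne: "1 - p$3 \<noteq> 0" using False third[OF p] by simp
        have "(cmod z)\<^sup>2 = ((p$1)\<^sup>2 + (p$2)\<^sup>2) / (1 - p$3)\<^sup>2"
          unfolding z_def cmod_power2 by (simp add: power_divide add_divide_distrib)
        also have "(p$1)\<^sup>2 + (p$2)\<^sup>2 = (1 - p$3) * (1 + p$3)"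
          using p unfolding sph by (simp add: algebra_simps power2_eq_square)
        also have "(1 - p$3) * (1 + p$3) / (1 - p$3)\<^sup>2 = (1 + p$3) / (1 - p$3)"
          using ne by (simp add: power2_eq_square)
        finally have "1 + (cmod z)\<^sup>2 = 2 / (1 - p$3)"
          using ne by (simp add: field_simps)
        then show ?thesis
          using ne False by (simp add: stereo_def g_def flip: z_def) (simp add: ext z_def diff_divide_distrib)
      qed
    qed
    have gs: "g w \<in> sphere 0 1" for w
    proof (cases w)
      case None
      then show ?thesis unfolding sph g_def by (simp add: np)
    next
      case (Some z)
      define d where "d = 1 + (cmod z)\<^sup>2"
      have d: "d > 0" "(Re z)\<^sup>2 + (Im z)\<^sup>2 = d - 1"
        using pos by (simp_all add: d_def cmod_power2 add_pos_nonneg)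
      have "(2 * Re z / d)\<^sup>2 + (2 * Im z / d)\<^sup>2 + (1 - 2 / d)\<^sup>2
          = 4 * ((Re z)\<^sup>2 + (Im z)\<^sup>2) / d\<^sup>2 + (1 - 2 / d)\<^sup>2"
        by (simp add: power_divide power_mult_distrib add_divide_distrib)
      also have "\<dots> = 1"
        unfolding d(2) using d(1) by (simp add: field_simps power2_eq_square)
      finally show ?thesis unfolding sph Some g_def d_def by simp
    qed
    then show "g ` UNIV \<subseteq> sphere 0 1" by blast
    show "\<forall>w\<in>UNIV. stereo (g w) = w"
    proof
      fix w
      show "stereo (g w) = w"
      proof (cases w)
        case None
        then show ?thesis by (simp add: stereo_def g_def)
      next
        case (Some z)
        have c: "1 - (g w)$3 = 2 / (1 + (cmod z)\<^sup>2)" by (simp add: Some g_def)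
        then have "g w \<noteq> north_pole"
          using pos[of z] third[OF gs] by auto
        then show ?thesis using pos[of z] unfolding stereo_def c
          by (simp add: Some g_def complex_eq_iff)
      qed
    qed
  qed simp
qed

definition chord :: "complex option \<Rightarrow> complex option \<Rightarrow> real" where
  "chord v w = norm (inv_stereo v - inv_stereo w)"

section \<open>Dyadic objects\<close>

text \<open>\<open>Segment a b\<close> is the interval $[a,b]$ of the real axis, \<open>Square a b\<close> the square with lower left
  corner $a$ and upper right corner $b$.\<close>

datatype dyadic = Segment real real | Square complex complex | Infinity

inductive is_dyadic :: "dyadic \<Rightarrow> bool" where
  "is_dyadic Infinity"
| "is_dyadic (Segment 0 4)"
| "is_dyadic (Segment a b) \<Longrightarrow> is_dyadic (Segment a (midpoint a b))"
| "is_dyadic (Segment a b) \<Longrightarrow> is_dyadic (Segment (midpoint a b) b)"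
| "is_dyadic (Square (Complex (-2) (-2)) (Complex 2 2))"
| "is_dyadic (Square a b) \<Longrightarrow> m = midpoint a b \<Longrightarrow> is_dyadic (Square a m)"
| "is_dyadic (Square a b) \<Longrightarrow> m = midpoint a b \<Longrightarrow> is_dyadic (Square m b)"
| "is_dyadic (Square a b) \<Longrightarrow> m = midpoint a b \<Longrightarrow>
     is_dyadic (Square (Complex (Re m) (Im a)) (Complex (Re b) (Im m)))"
| "is_dyadic (Square a b) \<Longrightarrow> m = midpoint a b \<Longrightarrow>
     is_dyadic (Square (Complex (Re a) (Im m)) (Complex (Re m) (Im b)))"

primrec plane_points :: "dyadic \<Rightarrow> complex set" where
  "plane_points (Segment a b) = complex_of_real ` {a..b}"
| "plane_points (Square a b) = cbox a b"
| "plane_points Infinity = {}"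

definition points :: "dyadic \<Rightarrow> complex option set" where
  "points Q = (if Q = Infinity then {None} else Some ` plane_points Q)"

primrec vertices :: "dyadic \<Rightarrow> complex option set" where
  "vertices (Segment a b) = {Some (complex_of_real a), Some (complex_of_real b)}"
| "vertices (Square a b) =
     {Some a, Some (Complex (Re b) (Im a)), Some (Complex (Re a) (Im b)), Some b}"
| "vertices Infinity = {None}"

primrec center :: "dyadic \<Rightarrow> complex option" where
  "center (Segment a b) = Some (complex_of_real (midpoint a b))"
| "center (Square a b) = Some (midpoint a b)"
| "center Infinity = None"

primrec normal_dyadic :: "dyadic \<Rightarrow> bool" where
  "normal_dyadic (Segment a b) = True"
| "normal_dyadic (Square a b) =
     (((\<forall>z\<in>cbox a b. Re z \<ge> 0) \<or> (\<forall>z\<in>cbox a b. Re z \<le> 0)) \<and>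
      ((\<forall>z\<in>cbox a b. Im z \<ge> 0) \<or> (\<forall>z\<in>cbox a b. Im z \<le> 0)))"
| "normal_dyadic Infinity = False"

text \<open>The plane points of a dyadic segment or square form a nonempty compact set, so that these
  infima and suprema are minima and maxima.\<close>

definition x_min :: "dyadic \<Rightarrow> real" where
  "x_min Q = (INF z\<in>plane_points Q. \<bar>Re z\<bar>)"

definition x_max :: "dyadic \<Rightarrow> real" where
  "x_max Q = (SUP z\<in>plane_points Q. \<bar>Re z\<bar>)"

definition y_min :: "dyadic \<Rightarrow> real" where
  "y_min Q = (INF z\<in>plane_points Q. \<bar>Im z\<bar>)"

definition y_max :: "dyadic \<Rightarrow> real" where
  "y_max Q = (SUP z\<in>plane_points Q. \<bar>Im z\<bar>)"

definition delta :: "dyadic \<Rightarrow> real" where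
  "delta Q = (if Q = Infinity then 0
     else 2 * (x_max Q - x_min Q) / (1 + (x_min Q)\<^sup>2 + (y_min Q)\<^sup>2))"

primrec tau :: "dyadic \<Rightarrow> real" where
  "tau (Segment a b) = 1"
| "tau (Square a b) = sqrt 2"
| "tau Infinity = 0"

section \<open>The separation bound\<close>

definition psi_min :: "dyadic \<Rightarrow> dyadic \<Rightarrow> real" where
  "psi_min Q Q' =
     (let D = chord (center Q) (center Q');
          d = (delta Q * tau Q + delta Q' * tau Q') / 4
      in Max ({0, D * (1 - d\<^sup>2 / 2) - sqrt (4 - D\<^sup>2) * d} \<union>
           (if normal_dyadic Q \<and> Q' = Infinity
            then {MIN v\<in>vertices Q. norm (inv_stereo v - north_pole)} else {})))"

section \<open>Blocks and energies\<close>

text \<open>A tuple $(Q_0,\dots,Q_n)$ is a function on \<^typ>\<open>nat\<close> of which only the values up to $n$ matter.\<close>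

definition block :: "nat \<Rightarrow> (nat \<Rightarrow> dyadic) \<Rightarrow> bool" where
  "block n Q \<longleftrightarrow> Q n = Infinity \<and> (\<forall>k<n. is_dyadic (Q k) \<and> Q k \<noteq> Infinity)"

definition dominated_configs :: "nat \<Rightarrow> (nat \<Rightarrow> dyadic) \<Rightarrow> (nat \<Rightarrow> complex option) set" where
  "dominated_configs n Q = (\<Pi>\<^sub>E k\<in>{..n}. points (Q k))"

definition vertex_configs :: "nat \<Rightarrow> (nat \<Rightarrow> dyadic) \<Rightarrow> (nat \<Rightarrow> complex option) set" where
  "vertex_configs n Q = (\<Pi>\<^sub>E k\<in>{..n}. vertices (Q k))"

text \<open>``Decreasing'' is meant in the weak sense. Only the values of the potential on $(0,\infty)$ matter.\<close>

definition admissible :: "(real \<Rightarrow> real) \<Rightarrow> bool" where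
  "admissible E \<longleftrightarrow>
     (\<forall>r>0. E r > 0) \<and>
     (\<forall>r>0. E differentiable at r \<and> deriv E differentiable at r) \<and>
     convex_on {0<..} E \<and>
     antimono_on {0<..} E \<and>
     (\<forall>r1 r2. 0 < r2 \<and> r2 \<le> r1 \<longrightarrow>
        (\<exists>c h. c \<ge> 1 \<and> h \<ge> 0 \<and>
           deriv E r2 / r2 = c * (deriv E r1 / r1) \<and>
           deriv (deriv E) r2 = (c + h) * deriv (deriv E) r1))"

definition energy :: "(real \<Rightarrow> real) \<Rightarrow> nat \<Rightarrow> (nat \<Rightarrow> complex option) \<Rightarrow> real" where
  "energy E n z = (\<Sum>j\<le>n. \<Sum>i<j. E (chord (z i) (z j)))"

text \<open>When the dominated configurations consist of distinct points, the energy is continuous on this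
  compact set and the infimum is a minimum.  Otherwise the value of \<^term>\<open>E 0\<close>, which has no meaning,
  may occur; two objects with a common point have separation bound $0$, so this is a case in
  which the error terms below are infinite.\<close>

definition min_energy :: "(real \<Rightarrow> real) \<Rightarrow> nat \<Rightarrow> (nat \<Rightarrow> dyadic) \<Rightarrow> real" where
  "min_energy E n Q = (INF z\<in>dominated_configs n Q. energy E n z)"

definition min_vertex_energy :: "(real \<Rightarrow> real) \<Rightarrow> nat \<Rightarrow> (nat \<Rightarrow> dyadic) \<Rightarrow> real" where
  "min_vertex_energy E n Q = (MIN z\<in>vertex_configs n Q. energy E n z)"

definition ERR :: "(real \<Rightarrow> real) \<Rightarrow> nat \<Rightarrow> (nat \<Rightarrow> dyadic) \<Rightarrow> real" where
  "ERR E n Q = min_vertex_energy E n Q - min_energy E n Q"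

section \<open>Error terms\<close>

text \<open>Both are used only when the first object is a segment or a square.\<close>

primrec (nonexhaustive) Lambda1 :: "(real \<Rightarrow> real) \<Rightarrow> dyadic \<Rightarrow> real \<Rightarrow> real" where
  "Lambda1 E (Segment a b) R =
     R / 32 * deriv E R + (1/8 - R\<^sup>2 / 32) * deriv (deriv E) R"
| "Lambda1 E (Square a b) R =
     R / 16 * deriv E R + (1/4 - R\<^sup>2 / 16) * deriv (deriv E) R"

primrec (nonexhaustive) Lambda2 :: "(real \<Rightarrow> real) \<Rightarrow> dyadic \<Rightarrow> real \<Rightarrow> real" where
  "Lambda2 E (Segment a b) R = - deriv E R / 8"
| "Lambda2 E (Square a b) R =
     - deriv E R / 7.98 *
       (sqrt (1 + (x_max (Square a b))\<^sup>2) + sqrt (1 + (y_max (Square a b))\<^sup>2))"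

definition err_eps :: "(real \<Rightarrow> real) \<Rightarrow> dyadic \<Rightarrow> dyadic \<Rightarrow> ereal" where
  "err_eps E Q Q' =
     (let R = psi_min Q Q'
      in if R = 0 then \<infinity> else ereal (max 0 (Lambda1 E Q R) + Lambda2 E Q R))"

end

theory Submission
  imports Defs
begin

text \<open>
  Replace the points of a configuration by vertices one at a time.  When $z_i$ moves along a horizontal
  or vertical line, its image moves on a circle of the sphere of curvature $k = \sqrt{1 + c^2}$, where
  $c$ is the fixed coordinate.  In arc length, the second derivative of
  $E(\|\gamma - q\|)$ is $E''(r)\,u - E'(r)\,(\langle\gamma'', q\rangle + u)/r$ with
  $u = \langle\gamma', q\rangle^2/r^2$.  Bessel's inequality for the orthonormal pair
  $\gamma, \gamma'$ gives $u \le 1 - r^2/4$, and the Cauchy-Schwarz inequality for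
  $\langle\gamma'', q - \gamma\rangle$ gives $\langle\gamma'', q\rangle \le k r - 1$, so the second
  derivative is at most $(1 - r^2/4)E''(r) + (r/4)E'(r) - k E'(r)$.  Admissibility bounds this by its value
  at the separation bound $R \le r$, up to replacing the first two terms by their positive part.
  Linear interpolation in arc length then costs at most
  $\delta^2/8$ times this bound, with weights that do not depend on $q$; hence one end of the line
  serves all the points $q_j$ at once.  A segment needs one such move; a square needs a horizontal one
  followed by a vertical one.
\<close>

section \<open>Admissible potentials along spherical arcs\<close>

text \<open>This is $8\max(0, \Lambda_1)$ for a segment and $4\max(0, \Lambda_1)$ for a square.\<close>

definition nonneg_bend :: "(real \<Rightarrow> real) \<Rightarrow> real \<Rightarrow> real" where
  "nonneg_bend E R = max 0 ((1 - R\<^sup>2 / 4) * deriv (deriv E) R + R / 4 * deriv E R)"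

section \<open>Signs and monotonicity of the derivatives of an admissible potential\<close>

lemma admissible_DERIV:
  assumes "admissible E" "r > 0"
  shows "(E has_real_derivative deriv E r) (at r)"
    and "(deriv E has_real_derivative deriv (deriv E) r) (at r)"
  using assms unfolding admissible_def by (auto simp: DERIV_deriv_iff_real_differentiable)

lemma admissible_deriv_nonpos:
  assumes "admissible E" "r > 0"
  shows "deriv E r \<le> 0"
proof -
  have "mono_on {0<..} (\<lambda>x. - E x)"
    using assms(1) by (auto simp: admissible_def monotone_on_def)
  then have "0 \<le> - deriv E r"
    by (rule mono_on_imp_deriv_nonneg[where x = r])
      (use assms in \<open>auto simp: interior_open intro!: DERIV_minus admissible_DERIV\<close>)
  then show ?thesis by simp
qed

lemma admissible_deriv_mono:
  assumes "admissible E" "0 < r" "r \<le> s"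
  shows "deriv E r \<le> deriv E s"
proof -
  have cvx: "convex_on {0<..} E" using assms(1) by (simp add: admissible_def)
  have tangent: "E y - E x \<ge> deriv E x * (y - x)" if "x > 0" "y > 0" for x y
    by (rule convex_on_imp_above_tangent[OF cvx])
      (use that has_field_derivative_at_within[OF admissible_DERIV(1)[OF assms(1)]]
        in \<open>auto simp: interior_open\<close>)
  \<comment> \<open>Add the tangent inequalities based at \<open>r\<close> and at
    \<open>s\<close>.\<close>
  have "(deriv E s - deriv E r) * (s - r) \<ge> 0"
    using tangent[of r s] tangent[of s r] assms by (simp add: algebra_simps)
  then show ?thesis using assms(3) by (cases "r = s") (auto simp: zero_le_mult_iff)
qed

lemma admissible_deriv2_nonneg:
  assumes "admissible E" "r > 0"
  shows "deriv (deriv E) r \<ge> 0"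
  by (rule mono_on_imp_deriv_nonneg[of "{0<..}" "deriv E" _ r])
    (use assms admissible_deriv_mono in \<open>auto simp: monotone_on_def interior_open intro!: admissible_DERIV\<close>)

text \<open>Going from \<open>r\<close> down to \<open>R\<close> multiplies E'/r by c and E'' by c +
  h. Since E' <= 0 and R^2/r <= r, each of the two summands at \<open>R\<close> is at least c times
  its value at \<open>r\<close>. As c >= 1, a positive sum at \<open>r\<close> can only grow, while
  a nonpositive one has positive part 0. The bound r <= 2 keeps 1 - r^2/4 nonnegative.\<close>

lemma bend_antimono:
  assumes "admissible E" "0 < R" "R \<le> r" "r \<le> 2"
  shows "nonneg_bend E r \<le> nonneg_bend E R"
proof (cases "(1 - r\<^sup>2 / 4) * deriv (deriv E) r + r / 4 * deriv E r \<le> 0")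
  case True
  then show ?thesis by (simp add: nonneg_bend_def)
next
  case False
  define A where "A = deriv E r"
  define B where "B = deriv (deriv E) r"
  obtain c h where ch: "c \<ge> 1" "h \<ge> 0" "deriv E R / R = c * (A / r)"
      "deriv (deriv E) R = (c + h) * B"
    using assms unfolding admissible_def A_def B_def by blast
  have A: "A \<le> 0" and B: "B \<ge> 0"
    using assms admissible_deriv_nonpos admissible_deriv2_nonneg by (auto simp: A_def B_def)
  have ER: "deriv E R = c * A * R / r" using ch(3) assms by (simp add: field_simps)
  have Rr: "R\<^sup>2 \<le> r\<^sup>2" using assms by (intro power_mono) auto
  have r4: "r\<^sup>2 \<le> 4" using power_mono[of r 2 2] assms by simp
  have "R\<^sup>2 / r \<le> r" using Rr assms by (simp add: field_simps power2_eq_square)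
  then have "(R\<^sup>2 / r) * (c * A) \<ge> r * (c * A)"
    using A ch(1) by (intro mult_right_mono_neg) (auto simp: mult_le_0_iff)
  then have 1: "R / 4 * deriv E R \<ge> c * (r / 4 * A)"
    unfolding ER by (simp add: field_simps power2_eq_square)
  have "(1 - R\<^sup>2 / 4) * ((c + h) * B) \<ge> (1 - r\<^sup>2 / 4) * (c * B)"
    using Rr r4 ch B by (intro mult_mono) (auto intro!: mult_right_mono)
  then have 2: "(1 - R\<^sup>2 / 4) * deriv (deriv E) R \<ge> c * ((1 - r\<^sup>2 / 4) * B)"
    unfolding ch(4) by (simp add: algebra_simps)
  have "(1 - r\<^sup>2 / 4) * B + r / 4 * A \<le> c * ((1 - r\<^sup>2 / 4) * B + r / 4 * A)"
    using ch(1) False by (auto simp: A_def B_def)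
  also have "\<dots> \<le> (1 - R\<^sup>2 / 4) * deriv (deriv E) R + R / 4 * deriv E R"
    using 1 2 by (simp add: distrib_left)
  finally show ?thesis by (auto simp: nonneg_bend_def A_def B_def)
qed

lemma interpolation_error:
  fixes f :: "real \<Rightarrow> real"
  assumes "a < b" "s \<in> {a..b}"
    and f': "\<And>x. x \<in> {a..b} \<Longrightarrow> (f has_real_derivative f' x) (at x)"
    and f'': "\<And>x. x \<in> {a..b} \<Longrightarrow> (f' has_real_derivative f'' x) (at x)"
    and M: "\<And>x. x \<in> {a..b} \<Longrightarrow> f'' x \<le> M" "M \<ge> 0"
  shows "(b - s) / (b - a) * f a + (s - a) / (b - a) * f b \<le> f s + (b - a)\<^sup>2 / 8 * M"
proof -
  define t where "t = (s - a) / (b - a)"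
  have t: "0 \<le> t" "t \<le> 1" using assms(1,2) by (auto simp: t_def)
  have tb: "t * (b - a) = s - a" using assms(1) by (simp add: t_def)
  then have s: "(1 - t) * a + t * b = s" by (simp add: algebra_simps)
  have t': "1 - t = (b - s) / (b - a)"
    using assms(1) tb by (simp add: eq_divide_eq) (simp add: algebra_simps)
  \<comment> \<open>Subtracting a parabola with second derivative \<open>M\<close> makes
    \<open>f\<close> concave, so its secant lies below it. The parabola itself contributes M/2 (b -
    a)^2 t(1 - t), and t(1 - t) <= 1/4 gives the factor 1/8.\<close>
  have "concave_on {a..b} (\<lambda>x. f x - M * x\<^sup>2 / 2)"
    by (rule f''_le0_imp_concave[where f' = "\<lambda>x. f' x - M * x" and f'' = "\<lambda>x. f'' x - M"])
      (use M f' f'' in \<open>auto intro!: derivative_eq_intros\<close>)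
  then have "(1 - t) * (f a - M * a\<^sup>2 / 2) + t * (f b - M * b\<^sup>2 / 2)
      \<le> f ((1 - t) * a + t * b) - M * ((1 - t) * a + t * b)\<^sup>2 / 2"
    using concave_onD[of "{a..b}" "\<lambda>x. f x - M * x\<^sup>2 / 2" t a b] t assms(1) by simp
  then have "(1 - t) * f a + t * f b
      \<le> f s + M / 2 * ((1 - t) * a\<^sup>2 + t * b\<^sup>2 - ((1 - t) * a + t * b)\<^sup>2)"
    unfolding s by (simp add: field_simps)
  also have "(1 - t) * a\<^sup>2 + t * b\<^sup>2 - ((1 - t) * a + t * b)\<^sup>2 = (b - a)\<^sup>2 * (t * (1 - t))"
    by (simp add: algebra_simps power2_eq_square)
  also have "M / 2 * ((b - a)\<^sup>2 * (t * (1 - t))) \<le> M / 2 * ((b - a)\<^sup>2 * (1 / 4))"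
  proof -
    have "t * (1 - t) \<le> 1 / 4"
      using zero_le_power2[of "t - 1/2"] by (simp add: algebra_simps power2_eq_square)
    then show ?thesis using M(2) by (intro mult_left_mono) auto
  qed
  finally show ?thesis unfolding t' unfolding t_def by (simp add: mult_ac)
qed

text \<open>\<open>T\<close> is the velocity and \<open>N\<close> the acceleration of a unit-speed
  curve. \<open>N\<close> is not normalised: its constant length \<kappa> is the curvature in the
  ambient space. Differentiating \<open>inner_T\<close> gives \<open>inner_N\<close>.\<close>

locale spherical_arc =
  fixes \<gamma> T N :: "real \<Rightarrow> 'a::real_inner" and \<kappa> :: real
  assumes \<gamma>': "(\<gamma> has_vector_derivative T s) (at s)"
    and T': "(T has_vector_derivative N s) (at s)"
    and norm_\<gamma>: "norm (\<gamma> s) = 1" and norm_T: "norm (T s) = 1" and norm_N: "norm (N s) = \<kappa>"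
    and inner_T: "\<gamma> s \<bullet> T s = 0" and inner_N: "\<gamma> s \<bullet> N s = - 1"
begin

text \<open>The left side is the second derivative in arc length of the energy between the moving
  point and \<open>q\<close>, in the form in which \<open>energy_interpolation_error\<close>
  computes it.\<close>

lemma energy_second_derivative_le:
  assumes E: "admissible E" and q: "norm q = 1" and R: "0 < R" "R \<le> norm (\<gamma> s - q)"
  defines "r \<equiv> norm (\<gamma> s - q)"
  shows "deriv (deriv E) r * (T s \<bullet> q)\<^sup>2 / r\<^sup>2 - deriv E r * ((N s \<bullet> q) / r + (T s \<bullet> q)\<^sup>2 / r ^ 3)
    \<le> nonneg_bend E R - \<kappa> * deriv E R"
proof -
  define A B u where "A = deriv E r" and "B = deriv (deriv E) r" and "u = (T s \<bullet> q)\<^sup>2 / r\<^sup>2"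
  have r: "0 < r" "R \<le> r" using R by (auto simp: r_def)
  have r2: "r \<le> 2" unfolding r_def using norm_triangle_ineq4[of "\<gamma> s" q] q norm_\<gamma>[of s] by simp
  have A: "A \<le> 0" and B: "B \<ge> 0"
    unfolding A_def B_def
    by (rule admissible_deriv_nonpos[OF E r(1)], rule admissible_deriv2_nonneg[OF E r(1)])
  have rq: "r\<^sup>2 = 2 - 2 * (\<gamma> s \<bullet> q)"
    using q norm_\<gamma>[of s] unfolding r_def norm_eq_1 power2_norm_eq_inner
    by (simp add: inner_diff inner_commute[of q "\<gamma> s"])
  have "(T s \<bullet> q)\<^sup>2 + (\<gamma> s \<bullet> q)\<^sup>2 \<le> 1"
  proof -
    \<comment> \<open>What remains of \<open>q\<close> after projection to the span of the
      orthonormal pair \<open>T s\<close>, \<open>\<gamma> s\<close>; its square being nonnegative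
      is Bessel's inequality.\<close>
    define p where "p = q - (T s \<bullet> q) *\<^sub>R T s - (\<gamma> s \<bullet> q) *\<^sub>R \<gamma> s"
    have "p \<bullet> p = 1 - (T s \<bullet> q)\<^sup>2 - (\<gamma> s \<bullet> q)\<^sup>2"
      using q norm_\<gamma>[of s] norm_T[of s] inner_T[of s] unfolding p_def norm_eq_1
      by (simp add: inner_diff inner_commute[of q "\<gamma> s"] inner_commute[of q "T s"] inner_commute[of "T s" "\<gamma> s"] power2_eq_square)
    with inner_ge_zero[of p] show ?thesis by simp
  qed
  moreover have "\<gamma> s \<bullet> q = 1 - r\<^sup>2 / 2" using rq by linarith
  ultimately have "(T s \<bullet> q)\<^sup>2 \<le> r\<^sup>2 * (1 - r\<^sup>2 / 4)"
    by (simp add: power2_eq_square algebra_simps)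
  then have u: "u \<le> 1 - r\<^sup>2 / 4" using r(1) by (simp add: u_def field_simps)
  \<comment> \<open>Applying Cauchy-Schwarz to \<open>q - \<gamma> s\<close>, of length
    \<open>r\<close>, instead of \<open>q\<close> makes the bound proportional to \<open>r\<close>.
    The term -1 coming from \<open>inner_N\<close> then cancels the 1 in the bound for
    \<open>u\<close>, so that division by \<open>r\<close> leaves \<kappa> - r/4.\<close>
  have "(q - \<gamma> s) \<bullet> N s \<le> r * \<kappa>"
    using norm_cauchy_schwarz[of "q - \<gamma> s" "N s"] by (simp add: norm_N r_def norm_minus_commute[of q "\<gamma> s"])
  then have N: "N s \<bullet> q \<le> r * \<kappa> - 1"
    using inner_N[of s] by (simp add: inner_diff inner_commute[of q "N s"])
  have "B * u - A * ((N s \<bullet> q) / r + u / r) \<le> B * (1 - r\<^sup>2 / 4) - A * (\<kappa> - r / 4)"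
  proof -
    have "(N s \<bullet> q) / r + u / r = (N s \<bullet> q + u) / r" by (simp add: add_divide_distrib)
    also have "\<dots> \<le> (r * \<kappa> - r\<^sup>2 / 4) / r" using u N r by (intro divide_right_mono) auto
    also have "\<dots> = \<kappa> - r / 4" using r by (simp add: field_simps power2_eq_square)
    finally show ?thesis
      using diff_mono[OF mult_left_mono[OF u B] mult_left_mono_neg[OF _ A]] by blast
  qed
  also have "\<dots> = ((1 - r\<^sup>2 / 4) * B + r / 4 * A) - \<kappa> * A"
    by (simp add: algebra_simps)
  also have "\<dots> \<le> nonneg_bend E r - \<kappa> * A"
    by (simp add: nonneg_bend_def A_def B_def)
  also have "\<dots> \<le> nonneg_bend E R - \<kappa> * deriv E R"
    using bend_antimono[OF E R(1) r(2) r2] admissible_deriv_mono[OF E R(1) r(2)] norm_N[of s]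
    by (intro diff_mono mult_left_mono) (auto simp: A_def)
  finally show ?thesis
    by (simp add: A_def B_def u_def power3_eq_cube power2_eq_square)
qed

text \<open>Between unit vectors the distance is a square root of an affine function of the inner
  product, hence differentiable while it is positive, which \<open>R\<close> ensures on the whole
  interval. The bound at \<open>R\<close> does not depend on the parameter and serves as the
  constant of \<open>interpolation_error\<close>.\<close>

lemma energy_interpolation_error:
  assumes E: "admissible E" and q: "norm q = 1" and "a < b" "s \<in> {a..b}"
    and R: "0 < R" "\<And>x. x \<in> {a..b} \<Longrightarrow> R \<le> norm (\<gamma> x - q)"
  shows "(b - s) / (b - a) * E (norm (\<gamma> a - q)) + (s - a) / (b - a) * E (norm (\<gamma> b - q))
    \<le> E (norm (\<gamma> s - q)) + (b - a)\<^sup>2 / 8 * (nonneg_bend E R - \<kappa> * deriv E R)"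
proof -
  define r where "r x = norm (\<gamma> x - q)" for x
  have r_pos: "r x > 0" if "x \<in> {a..b}" for x
    using R(2)[OF that] R(1) unfolding r_def by linarith
  have r_eq: "r x = sqrt (2 - 2 * (\<gamma> x \<bullet> q))" for x
    using q norm_\<gamma>[of x] unfolding r_def norm_eq_1 norm_eq_sqrt_inner
    by (simp add: inner_diff inner_commute[of q "\<gamma> x"])
  have g: "((\<lambda>x. \<gamma> x \<bullet> q) has_real_derivative T x \<bullet> q) (at x)" for x
    using bounded_linear.has_vector_derivative[OF bounded_linear_inner_left \<gamma>'[of x], of q]
    by (simp add: has_real_derivative_iff_has_vector_derivative)
  have g': "((\<lambda>x. T x \<bullet> q) has_real_derivative N x \<bullet> q) (at x)" for x
    using bounded_linear.has_vector_derivative[OF bounded_linear_inner_left T'[of x], of q]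
    by (simp add: has_real_derivative_iff_has_vector_derivative)
  have r': "(r has_real_derivative - (T x \<bullet> q) / r x) (at x)" if "x \<in> {a..b}" for x
  proof -
    have "2 - 2 * (\<gamma> x \<bullet> q) > 0" using r_pos[OF that] unfolding r_eq by simp
    then have "((\<lambda>x. sqrt (2 - 2 * (\<gamma> x \<bullet> q))) has_real_derivative
        - (T x \<bullet> q) / sqrt (2 - 2 * (\<gamma> x \<bullet> q))) (at x)"
      by (auto intro!: derivative_eq_intros g simp: divide_simps)
    then show ?thesis by (simp flip: r_eq)
  qed
  have f': "((\<lambda>x. E (r x)) has_real_derivative - (deriv E (r x) * (T x \<bullet> q) / r x)) (at x)"
    if "x \<in> {a..b}" for x
    using DERIV_chain2[OF admissible_DERIV(1)[OF E r_pos[OF that]] r'[OF that]] by simp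
  have f'': "((\<lambda>x. - (deriv E (r x) * (T x \<bullet> q) / r x)) has_real_derivative
      deriv (deriv E) (r x) * (T x \<bullet> q)\<^sup>2 / (r x)\<^sup>2
      - deriv E (r x) * ((N x \<bullet> q) / r x + (T x \<bullet> q)\<^sup>2 / r x ^ 3)) (at x)"
    if "x \<in> {a..b}" for x
  proof -
    note d = DERIV_chain2[OF admissible_DERIV(2)[OF E r_pos[OF that]] r'[OF that]]
    show ?thesis
      using r_pos[OF that]
      by (auto intro!: derivative_eq_intros d g' r' that
          simp: field_simps power2_eq_square power3_eq_cube)
  qed
  have "nonneg_bend E R - \<kappa> * deriv E R \<ge> 0"
    using mult_nonneg_nonpos[of \<kappa>, OF _ admissible_deriv_nonpos[OF E R(1)]]
      norm_ge_zero[of "N s", unfolded norm_N]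
    by (simp add: nonneg_bend_def le_max_iff_disj)
  then show ?thesis
    using interpolation_error[OF \<open>a < b\<close> \<open>s \<in> {a..b}\<close> f' f'',
        of "nonneg_bend E R - \<kappa> * deriv E R"]
      energy_second_derivative_le[OF E q R(1), folded r_def] R(2)
    by (simp add: r_def)
qed

end

section \<open>Images of horizontal and vertical lines\<close>

lemma inv_stereo_eqI:
  assumes "p \<in> sphere 0 1" "stereo p = w"
  shows "inv_stereo w = p"
  using assms bij_betw_inv_into_left[OF bij_betw_stereo] by (auto simp: inv_stereo_def)

lemma norm_inv_stereo [simp]: "norm (inv_stereo w) = 1"
proof -
  have "inv_stereo w \<in> sphere 0 1"
    unfolding inv_stereo_def using bij_betw_stereo
    by (metis UNIV_I bij_betw_def inv_into_into)
  then show ?thesis by simp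
qed

lemma norm_real3_eq_1: "norm p = 1 \<longleftrightarrow> (p$1)\<^sup>2 + (p$2)\<^sup>2 + (p$3)\<^sup>2 = 1" for p :: "real^3"
  by (simp add: norm_eq_1 inner_vec_def sum_3 power2_eq_square)

lemma inv_stereo_None: "inv_stereo None = north_pole"
  by (rule inv_stereo_eqI) (simp_all add: norm_real3_eq_1 north_pole_def stereo_def)

lemma inv_stereo_Some:
  "inv_stereo (Some z) =
     vector [2 * Re z / (1 + (cmod z)\<^sup>2), 2 * Im z / (1 + (cmod z)\<^sup>2), 1 - 2 / (1 + (cmod z)\<^sup>2)]"
proof (rule inv_stereo_eqI)
  define d where "d = 1 + (cmod z)\<^sup>2"
  have d: "d > 0" "(Re z)\<^sup>2 + (Im z)\<^sup>2 = d - 1"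
    by (simp_all add: d_def cmod_power2 add_pos_nonneg)
  have "(2 * Re z / d)\<^sup>2 + (2 * Im z / d)\<^sup>2 + (1 - 2 / d)\<^sup>2
      = 4 * ((Re z)\<^sup>2 + (Im z)\<^sup>2) / d\<^sup>2 + (1 - 2 / d)\<^sup>2"
    by (simp add: power_divide power_mult_distrib add_divide_distrib)
  also have "\<dots> = 1"
    unfolding d(2) using d(1) by (simp add: field_simps power2_eq_square)
  finally show "vector [2 * Re z / d, 2 * Im z / d, 1 - 2 / d] \<in> (sphere 0 1 :: (real^3) set)"
    by (simp add: norm_real3_eq_1)
  have "vector [2 * Re z / d, 2 * Im z / d, 1 - 2 / d] \<noteq> north_pole"
    using d(1) by (auto simp: north_pole_def vec_eq_iff forall_3)
  then show "stereo (vector [2 * Re z / d, 2 * Im z / d, 1 - 2 / d]) = Some z"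
    using d(1) by (simp add: stereo_def complex_eq_iff)
qed

text \<open>The image of a line in the plane, parametrized by arc length: \<open>e\<close> is the direction of the line,
  \<open>c *\<^sub>R e'\<close> its point closest to the origin, and \<open>k\<close> the curvature of the image circle.\<close>

definition line_arc :: "real^3 \<Rightarrow> real^3 \<Rightarrow> real \<Rightarrow> real \<Rightarrow> real^3" where
  "line_arc e e' c s =
     (let k = sqrt (1 + c\<^sup>2) in (sin (k * s) / k) *\<^sub>R e
       + ((1 + cos (k * s)) / k\<^sup>2) *\<^sub>R (c *\<^sub>R e' - north_pole) + north_pole)"

text \<open>Arc length along the image of the line, measured from x = 0: the antiderivative of the
  conformal factor 2/(1 + c^2 + x^2).\<close>

definition arc_param :: "real \<Rightarrow> real \<Rightarrow> real" where
  "arc_param c x = (let k = sqrt (1 + c\<^sup>2) in 2 * arctan (x / k) / k)"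

text \<open>Together with \<open>north_pole\<close> an orthonormal basis of either orientation, so
  that one computation covers horizontal and vertical lines.\<close>

definition orthonormal_frame :: "real^3 \<Rightarrow> real^3 \<Rightarrow> bool" where
  "orthonormal_frame e e' \<longleftrightarrow> norm e = 1 \<and> norm e' = 1 \<and> e \<bullet> e' = 0 \<and>
     e \<bullet> north_pole = 0 \<and> e' \<bullet> north_pole = 0"

lemma orthonormal_frame_axis:
  "orthonormal_frame (axis 1 1) (axis 2 1)" "orthonormal_frame (axis 2 1) (axis 1 1)"
  by (simp_all add: orthonormal_frame_def norm_eq_1 inner_vec_def sum_3 north_pole_def axis_def)

text \<open>The vectors e and b/k, with b = c e' - \<open>north_pole\<close> of length k, are
  orthonormal. The curve is the circle of radius 1/k around \<open>north_pole\<close> + b/k^2 in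
  their directions, run through with angular speed k. All requirements reduce to the table
  \<open>ip\<close> of inner products.\<close>

lemma spherical_arc_line_arc:
  assumes "orthonormal_frame e e'"
  shows "\<exists>T N. spherical_arc (line_arc e e' c) T N (sqrt (1 + c\<^sup>2))"
proof -
  define k where "k = sqrt (1 + c\<^sup>2)"
  have k: "k > 0" "k\<^sup>2 = 1 + c\<^sup>2" by (simp_all add: k_def add_pos_nonneg)
  define b where "b = c *\<^sub>R e' - north_pole"
  have np: "north_pole \<bullet> north_pole = 1"
    using norm_inv_stereo[of None] by (simp add: inv_stereo_None norm_eq_1)
  have ip: "e \<bullet> e = 1" "e \<bullet> b = 0" "b \<bullet> e = 0" "b \<bullet> b = k\<^sup>2" "e \<bullet> north_pole = 0"
    "north_pole \<bullet> e = 0" "b \<bullet> north_pole = - 1" "north_pole \<bullet> b = - 1"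
    using assms np unfolding orthonormal_frame_def b_def k(2) norm_eq_1
    by (simp_all add: inner_diff inner_commute[of e' e] inner_commute[of north_pole e]
        inner_commute[of north_pole e'] power2_eq_square)
  have arc: "line_arc e e' c = (\<lambda>s. (sin (k * s) / k) *\<^sub>R e + ((1 + cos (k * s)) / k\<^sup>2) *\<^sub>R b + north_pole)"
    by (rule ext) (simp add: line_arc_def Let_def k_def b_def)
  define T where "T s = cos (k * s) *\<^sub>R e + (- sin (k * s) / k) *\<^sub>R b" for s
  define N where "N s = (- k * sin (k * s)) *\<^sub>R e + (- cos (k * s)) *\<^sub>R b" for s
  have sc: "(sin x)\<^sup>2 = 1 - (cos x)\<^sup>2" for x :: real by (simp add: sin_squared_eq)
  have "spherical_arc (line_arc e e' c) T N k"
  proof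
    fix s
    show "(line_arc e e' c has_vector_derivative T s) (at s)"
      unfolding arc T_def using k(1)
      by (auto intro!: derivative_eq_intros simp: power2_eq_square)
    show "(T has_vector_derivative N s) (at s)"
      unfolding T_def[abs_def] N_def using k(1)
      by (auto intro!: derivative_eq_intros)
    show "norm (line_arc e e' c s) = 1"
      unfolding arc norm_eq_1 using k(1)
      by (simp add: inner_add ip np)
        (simp add: divide_simps, simp add: algebra_simps sc flip: power2_eq_square)
    show "norm (T s) = 1"
    proof -
      have "T s \<bullet> T s = (cos (k * s))\<^sup>2 + (sin (k * s) / k)\<^sup>2 * k\<^sup>2"
        unfolding T_def by (simp add: inner_diff ip power2_eq_square)
      also have "\<dots> = 1" using k(1) by (simp add: power_divide)
      finally show ?thesis by (simp add: norm_eq_1)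
    qed
    have "N s \<bullet> N s = k\<^sup>2"
      unfolding N_def by (simp add: inner_add ip algebra_simps sc flip: power2_eq_square)
    then show "norm (N s) = k"
      using k(1) by (simp add: norm_eq_sqrt_inner)
    show "line_arc e e' c s \<bullet> T s = 0"
      unfolding arc T_def using k(1)
      by (simp add: inner_add inner_diff ip)
    show "line_arc e e' c s \<bullet> N s = - 1"
      unfolding arc N_def using k(1)
      by (simp add: inner_add inner_diff ip) (simp add: algebra_simps sc flip: power2_eq_square)
  qed
  then show ?thesis unfolding k_def by blast
qed

text \<open>At this parameter the central angle is 2 arctan(x/k), and the double-angle formulas make
  its sine and cosine rational in x.\<close>

lemma line_arc_arc_param:
  "line_arc e e' c (arc_param c x) =
     (2 * x / (1 + c\<^sup>2 + x\<^sup>2)) *\<^sub>R e + (2 / (1 + c\<^sup>2 + x\<^sup>2)) *\<^sub>R (c *\<^sub>R e' - north_pole) + north_pole"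
proof -
  define k where "k = sqrt (1 + c\<^sup>2)"
  have k: "k > 0" "k\<^sup>2 = 1 + c\<^sup>2" by (simp_all add: k_def add_pos_nonneg)
  define t where "t = arctan (x / k)"
  have t: "sin t = x / k * cos t" and ct: "(cos t)\<^sup>2 = k\<^sup>2 / (k\<^sup>2 + x\<^sup>2)"
  proof -
    have pos: "1 + (x / k)\<^sup>2 > 0" by (simp add: add_pos_nonneg)
    show "sin t = x / k * cos t" by (simp add: t_def sin_arctan cos_arctan)
    show "(cos t)\<^sup>2 = k\<^sup>2 / (k\<^sup>2 + x\<^sup>2)"
      using pos k(1) by (simp add: t_def cos_arctan power_divide) (simp add: field_simps)
  qed
  have "k * arc_param c x = 2 * t"
    using k(1) by (simp add: arc_param_def Let_def t_def flip: k_def)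
  moreover have "sin (2 * t) / k = 2 * x / (k\<^sup>2 + x\<^sup>2)"
  proof -
    have "sin (2 * t) / k = 2 * x / k\<^sup>2 * (cos t)\<^sup>2"
      by (simp add: sin_double t power2_eq_square)
    then show ?thesis using k(1) by (simp add: ct)
  qed
  moreover have "(1 + cos (2 * t)) / k\<^sup>2 = 2 / (k\<^sup>2 + x\<^sup>2)"
    using k(1) by (simp add: cos_double_cos ct)
  ultimately show ?thesis
    by (simp add: line_arc_def Let_def flip: k_def) (simp add: k(2))
qed

lemma inv_stereo_eq_line_arc:
  "inv_stereo (Some (Complex x y)) = line_arc (axis 1 1) (axis 2 1) y (arc_param y x)"
  "inv_stereo (Some (Complex x y)) = line_arc (axis 2 1) (axis 1 1) x (arc_param x y)"
  unfolding line_arc_arc_param inv_stereo_Some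
  by (simp_all add: vec_eq_iff forall_3 north_pole_def axis_def cmod_power2 add_ac)

lemma arc_param_strict_mono: "x < y \<Longrightarrow> arc_param c x < arc_param c y"
  by (simp add: arc_param_def Let_def arctan_less_iff divide_strict_right_mono add_pos_nonneg)

lemma arc_param_mono: "x \<le> y \<Longrightarrow> arc_param c x \<le> arc_param c y"
  using arc_param_strict_mono[of x y c] by (cases "x = y") auto

text \<open>Separation bounds are known for points of the plane, whereas interpolation requires them
  at every arc length between the ends. The preimage is obtained by inverting the arc
  tangent.\<close>

lemma arc_param_surj:
  assumes "arc_param c x \<le> s" "s \<le> arc_param c y"
  shows "\<exists>\<xi>\<in>{x..y}. arc_param c \<xi> = s"
proof -
  define k where "k = sqrt (1 + c\<^sup>2)"
  have k: "k > 0" by (simp add: k_def add_pos_nonneg)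
  define u where "u = k * s / 2"
  have u: "arctan (x / k) \<le> u" "u \<le> arctan (y / k)"
    using assms k by (auto simp: arc_param_def Let_def u_def field_simps simp flip: k_def)
  then have "- (pi / 2) < u" "u < pi / 2"
    using arctan_lbound[of "x / k"] arctan_ubound[of "y / k"] by linarith+
  then have tan: "arctan (tan u) = u" by (rule arctan_tan)
  then have s: "arc_param c (k * tan u) = s"
    using k by (simp add: arc_param_def Let_def flip: k_def) (simp add: u_def)
  have "arctan (x / k) \<le> arctan (tan u)" "arctan (tan u) \<le> arctan (y / k)"
    using u tan by auto
  then have "x \<le> k * tan u" "k * tan u \<le> y"
    using k unfolding arctan_le_iff by (auto simp: field_simps)
  with s show ?thesis by auto
qed

text \<open>The mean value theorem for the conformal factor. With \<open>m\<close> the denominator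
  of \<open>delta\<close>, it shows that the image of a side has length at most
  \<open>delta\<close>.\<close>

lemma arc_param_diff_le:
  assumes "x < y" "0 < m" "\<And>\<xi>. \<xi> \<in> {x..y} \<Longrightarrow> m \<le> 1 + c\<^sup>2 + \<xi>\<^sup>2"
  shows "arc_param c y - arc_param c x \<le> 2 * (y - x) / m"
proof -
  define k where "k = sqrt (1 + c\<^sup>2)"
  have k: "k > 0" "k\<^sup>2 = 1 + c\<^sup>2" by (simp_all add: k_def add_pos_nonneg)
  have "(arc_param c has_real_derivative 2 / (1 + c\<^sup>2 + \<xi>\<^sup>2)) (at \<xi>)" for \<xi>
  proof -
    have "1 + (\<xi> / k)\<^sup>2 > 0" "k\<^sup>2 + \<xi>\<^sup>2 > 0" using k(1) by (simp_all add: add_pos_nonneg)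
    then have "((\<lambda>x. 2 * arctan (x / k) / k) has_real_derivative 2 / (k\<^sup>2 + \<xi>\<^sup>2)) (at \<xi>)"
      using k(1) by (auto intro!: derivative_eq_intros simp: divide_simps) (simp add: field_simps power2_eq_square)
    then show ?thesis unfolding arc_param_def[abs_def] Let_def k_def[symmetric] k(2) .
  qed
  from MVT2[OF assms(1) this] obtain \<xi> where
    \<xi>: "\<xi> > x" "\<xi> < y" "arc_param c y - arc_param c x = (y - x) * (2 / (1 + c\<^sup>2 + \<xi>\<^sup>2))"
    by blast
  have "2 / (1 + c\<^sup>2 + \<xi>\<^sup>2) \<le> 2 / m"
    using assms(2) assms(3)[of \<xi>] \<xi> by (intro divide_left_mono) auto
  then have "(y - x) * (2 / (1 + c\<^sup>2 + \<xi>\<^sup>2)) \<le> (y - x) * (2 / m)"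
    using assms(1) by (intro mult_left_mono) auto
  then show ?thesis unfolding \<xi>(3) by (simp add: mult_ac)
qed

text \<open>The interpolation weights 1 - t and t depend on \<open>x\<close> only. Summing over j
  therefore bounds one convex combination of the total energies at the two ends, and the smaller of
  these is at most that combination.\<close>

lemma endpoint_energy_le:
  fixes q :: "'j \<Rightarrow> real^3"
  assumes E: "admissible E" and frame: "orthonormal_frame e e'"
    and p: "\<And>\<xi>. p \<xi> = line_arc e e' c (arc_param c \<xi>)"
    and x: "a < b" "x \<in> {a..b}"
    and m: "0 < m" "\<And>\<xi>. \<xi> \<in> {a..b} \<Longrightarrow> m \<le> 1 + c\<^sup>2 + \<xi>\<^sup>2"
    and q: "\<And>j. j \<in> J \<Longrightarrow> norm (q j) = 1"
    and R: "\<And>j. j \<in> J \<Longrightarrow> 0 < R j" "\<And>j \<xi>. j \<in> J \<Longrightarrow> \<xi> \<in> {a..b} \<Longrightarrow> R j \<le> norm (p \<xi> - q j)"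
  shows "\<exists>x'\<in>{a, b}. (\<Sum>j\<in>J. E (norm (p x' - q j))) \<le> (\<Sum>j\<in>J. E (norm (p x - q j)))
     + (\<Sum>j\<in>J. (2 * (b - a) / m)\<^sup>2 / 8 * (nonneg_bend E (R j) - sqrt (1 + c\<^sup>2) * deriv E (R j)))"
    (is "\<exists>x'\<in>_. ?S x' \<le> _ + (\<Sum>j\<in>J. ?L\<^sup>2 / 8 * ?M j)")
proof -
  define \<sigma> where "\<sigma> = arc_param c"
  define t where "t = (\<sigma> x - \<sigma> a) / (\<sigma> b - \<sigma> a)"
  obtain T N where "spherical_arc (line_arc e e' c) T N (sqrt (1 + c\<^sup>2))"
    using spherical_arc_line_arc[OF frame] by blast
  then interpret spherical_arc "line_arc e e' c" T N "sqrt (1 + c\<^sup>2)" .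
  have ab: "\<sigma> a < \<sigma> b" using x(1) by (simp add: \<sigma>_def arc_param_strict_mono)
  have xab: "\<sigma> x \<in> {\<sigma> a..\<sigma> b}" using x(2) by (simp add: \<sigma>_def arc_param_mono)
  have t: "0 \<le> t" "t \<le> 1" using ab xab by (auto simp: t_def)
  have t': "1 - t = (\<sigma> b - \<sigma> x) / (\<sigma> b - \<sigma> a)"
    using ab by (simp add: t_def diff_divide_eq_iff)
  have L: "(\<sigma> b - \<sigma> a)\<^sup>2 \<le> ?L\<^sup>2"
    using arc_param_diff_le[OF x(1) m] ab by (intro power_mono) (auto simp: \<sigma>_def)
  have le: "(1 - t) * E (norm (p a - q j)) + t * E (norm (p b - q j))
      \<le> E (norm (p x - q j)) + ?L\<^sup>2 / 8 * ?M j" if j: "j \<in> J" for j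
  proof -
    have "R j \<le> norm (line_arc e e' c s - q j)" if "s \<in> {\<sigma> a..\<sigma> b}" for s
      using arc_param_surj[of c a s b] that R(2)[OF j] unfolding \<sigma>_def p by auto
    then have "(1 - t) * E (norm (p a - q j)) + t * E (norm (p b - q j))
      \<le> E (norm (p x - q j)) + (\<sigma> b - \<sigma> a)\<^sup>2 / 8 * ?M j"
      using energy_interpolation_error[OF E q[OF j] ab xab R(1)[OF j]]
      unfolding t' unfolding t_def p \<sigma>_def[symmetric] by blast
    \<comment> \<open>The sign allows replacing the true arc length by its upper bound.\<close>
    moreover have "?M j \<ge> 0"
      using mult_nonneg_nonpos[of "sqrt (1 + c\<^sup>2)" "deriv E (R j)"]
        admissible_deriv_nonpos[OF E R(1)[OF j]]
      by (simp add: nonneg_bend_def le_max_iff_disj)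
    then have "(\<sigma> b - \<sigma> a)\<^sup>2 / 8 * ?M j \<le> ?L\<^sup>2 / 8 * ?M j"
      using L by (intro mult_right_mono) auto
    ultimately show ?thesis by linarith
  qed
  have "(1 - t) * ?S a + t * ?S b \<le> ?S x + (\<Sum>j\<in>J. ?L\<^sup>2 / 8 * ?M j)"
    using sum_mono[OF le, of J id] by (simp add: sum.distrib sum_distrib_left)
  moreover have "min (?S a) (?S b) \<le> (1 - t) * ?S a + t * ?S b"
    using convex_bound_le[of "- ?S a" "- min (?S a) (?S b)" "- ?S b" "1 - t" t] t by simp
  ultimately show ?thesis by (auto simp: min_def split: if_splits)
qed

section \<open>Angles and the stereographic projection\<close>

text \<open>On unit vectors this is the great-circle distance.\<close>

definition ang :: "real^3 \<Rightarrow> real^3 \<Rightarrow> real" where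
  "ang p q = arccos (p \<bullet> q)"

lemma inner_unit_bounds:
  assumes "norm p = 1" "norm q = 1"
  shows "- 1 \<le> p \<bullet> q" "p \<bullet> q \<le> 1"
  using Cauchy_Schwarz_ineq2[of p q] assms by auto

lemma cos_ang:
  assumes "norm p = 1" "norm q = 1"
  shows "cos (ang p q) = p \<bullet> q" "0 \<le> ang p q" "ang p q \<le> pi"
  using arccos[OF inner_unit_bounds[OF assms]] by (simp_all add: ang_def)

text \<open>Removing the components along \<open>c\<close> leaves vectors whose lengths are the
  sines of the two angles. Cauchy-Schwarz for them says that the inner product of \<open>p\<close>
  and \<open>q\<close> is at least the cosine of the sum of the angles. If the sum exceeds pi, the
  claim is trivial.\<close>

lemma ang_triangle:
  assumes "norm p = 1" "norm q = 1" "norm c = 1"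
  shows "ang p q \<le> ang p c + ang c q"
proof (cases "ang p c + ang c q \<le> pi")
  case False
  then show ?thesis using cos_ang[OF assms(1,2)] by linarith
next
  case True
  define p' where "p' = p - (p \<bullet> c) *\<^sub>R c"
  define q' where "q' = q - (c \<bullet> q) *\<^sub>R c"
  have "p' \<bullet> p' = 1 - (p \<bullet> c)\<^sup>2"
    using assms unfolding p'_def norm_eq_1
    by (simp add: inner_diff inner_commute[of c p] power2_eq_square)
  then have p': "norm p' = sin (ang p c)"
    using cos_ang[OF assms(1,3)] sin_ge_zero[of "ang p c"]
    by (simp add: norm_eq_sqrt_inner real_sqrt_unique sin_squared_eq)
  have "q' \<bullet> q' = 1 - (c \<bullet> q)\<^sup>2"
    using assms unfolding q'_def norm_eq_1
    by (simp add: inner_diff inner_commute[of q c] power2_eq_square)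
  then have q': "norm q' = sin (ang c q)"
    using cos_ang[OF assms(3,2)] sin_ge_zero[of "ang c q"]
    by (simp add: norm_eq_sqrt_inner real_sqrt_unique sin_squared_eq)
  have "p' \<bullet> q' = p \<bullet> q - (p \<bullet> c) * (c \<bullet> q)"
    using assms unfolding p'_def q'_def norm_eq_1
    by (simp add: inner_diff)
  moreover have "p' \<bullet> q' \<ge> - (norm p' * norm q')"
    using Cauchy_Schwarz_ineq2[of p' q'] by linarith
  ultimately have "cos (ang p c + ang c q) \<le> cos (ang p q)"
    using assms by (simp add: cos_add cos_ang p' q')
  then show ?thesis
    using True cos_ang[OF assms(1,2)] cos_ang[OF assms(1,3)] cos_ang[OF assms(3,2)]
    by (subst (asm) cos_mono_le_eq) auto
qed

lemma norm_diff_eq_sin_ang: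
  assumes "norm p = 1" "norm q = 1"
  shows "norm (p - q) = 2 * sin (ang p q / 2)"
proof -
  have "(norm (p - q))\<^sup>2 = 2 - 2 * (p \<bullet> q)"
    using assms unfolding power2_norm_eq_inner norm_eq_1
    by (simp add: inner_diff inner_commute[of q p])
  also have "\<dots> = (2 * sin (ang p q / 2))\<^sup>2"
    using cos_double_sin[of "ang p q / 2"] cos_ang[OF assms] by (simp add: power_mult_distrib)
  finally show ?thesis
    by (rule power2_eq_imp_eq) (use cos_ang[OF assms] sin_ge_zero[of "ang p q / 2"] in auto)
qed

section \<open>From angles to distances in space, and angles in plane coordinates\<close>

lemma cos_ge_one_minus_half_square: "1 - x\<^sup>2 / 2 \<le> cos x" for x :: real
proof -
  have "(sin (x / 2))\<^sup>2 \<le> (x / 2)\<^sup>2"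
    using abs_sin_x_le_abs_x[of "x / 2"] by (simp only: abs_le_square_iff)
  then show ?thesis using cos_double_sin[of "x / 2"] by (simp add: power_divide)
qed

text \<open>With D = 2 sin t and d = a + b, the triangle inequality for angles shows that half the
  angle between \<open>p\<close> and \<open>q\<close> is at least t - d. Hence the distance is at
  least 2 sin(t - d) = D cos d - sqrt(4 - D^2) sin d, and cos d >= 1 - d^2/2, sin d <= d give the
  stated form.\<close>

lemma norm_diff_ge_of_ang_le:
  assumes u: "norm p = 1" "norm q = 1" "norm c = 1" "norm c' = 1"
    and a: "ang p c \<le> 2 * a" "ang q c' \<le> 2 * b"
  defines "D \<equiv> norm (c - c')"
  shows "D * (1 - (a + b)\<^sup>2 / 2) - sqrt (4 - D\<^sup>2) * (a + b) \<le> norm (p - q)"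
proof -
  define d where "d = a + b"
  define t where "t = ang c c' / 2"
  have sym: "ang x y = ang y x" for x y by (simp add: ang_def inner_commute)
  have d0: "d \<ge> 0" using a cos_ang(2)[OF u(1,3)] cos_ang(2)[OF u(2,4)] by (simp add: d_def)
  have t: "0 \<le> t" "t \<le> pi / 2" using cos_ang[OF u(3,4)] by (simp_all add: t_def)
  have D: "D = 2 * sin t" unfolding D_def t_def by (rule norm_diff_eq_sin_ang) fact+
  have ct: "cos t \<ge> 0" using t by (intro cos_ge_zero) auto
  have st: "sin t \<ge> 0" using t by (intro sin_ge_zero) auto
  have sq: "sqrt (4 - D\<^sup>2) = 2 * cos t"
    using ct by (intro real_sqrt_unique) (simp_all add: D power_mult_distrib cos_squared_eq)
  show ?thesis
  \<comment> \<open>For large d both terms on the left are at most 0. Otherwise d < 2 < pi, so that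
    sin(d - t) >= 0 is available when t <= d.\<close>
  proof (cases "d\<^sup>2 \<ge> 2")
    case True
    then have "D * (1 - d\<^sup>2 / 2) \<le> 0" using st by (simp add: D mult_nonneg_nonpos)
    moreover have "sqrt (4 - D\<^sup>2) * d \<ge> 0" using ct d0 by (simp add: sq)
    ultimately show ?thesis unfolding d_def[symmetric] using norm_ge_zero[of "p - q"] by linarith
  next
    case False
    then have d2: "d < 2" using d0 power_mono[of 2 d 2] by force
    have "D * (1 - d\<^sup>2 / 2) - sqrt (4 - D\<^sup>2) * d \<le> 2 * sin t * cos d - 2 * cos t * sin d"
      unfolding sq unfolding D using st ct sin_x_le_x[OF d0] cos_ge_one_minus_half_square[of d]
      by (intro diff_mono mult_left_mono) auto
    also have "\<dots> = 2 * sin (t - d)" by (simp add: sin_diff algebra_simps)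
    also have "\<dots> \<le> norm (p - q)"
    proof (cases "t \<le> d")
      case True
      have "sin (d - t) \<ge> 0" using True t d2 pi_gt3 by (intro sin_ge_zero) auto
      then show ?thesis using sin_minus[of "d - t"] norm_ge_zero[of "p - q"] by (smt (verit) minus_diff_eq)
    next
      case False
      have "ang c c' \<le> ang c p + (ang p q + ang q c')"
        using ang_triangle[OF u(3,4,1)] ang_triangle[OF u(1,4,2)] by linarith
      then have "t - d \<le> ang p q / 2" using a by (simp add: t_def d_def sym[of c p])
      then have "sin (t - d) \<le> sin (ang p q / 2)"
        using False t d0 cos_ang[OF u(1,2)] by (intro sin_monotone_2pi_le) auto
      then show ?thesis by (simp add: norm_diff_eq_sin_ang[OF u(1,2)])
    qed
    finally show ?thesis unfolding d_def .
  qed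
qed

text \<open>The sum of the two squares is (1 + |z|^2)(1 + |w|^2). This form displays the inner
  product as the cosine of a doubled angle whose tangent is a quotient of moduli.\<close>

lemma inner_inv_stereo:
  "inv_stereo (Some z) \<bullet> inv_stereo (Some w) =
     ((cmod (1 + cnj z * w))\<^sup>2 - (cmod (z - w))\<^sup>2) / ((cmod (1 + cnj z * w))\<^sup>2 + (cmod (z - w))\<^sup>2)"
proof -
  define d where "d = 1 + (cmod z)\<^sup>2"
  define e where "e = 1 + (cmod w)\<^sup>2"
  have d: "d > 0" "(Re z)\<^sup>2 + (Im z)\<^sup>2 = d - 1" and e: "e > 0" "(Re w)\<^sup>2 + (Im w)\<^sup>2 = e - 1"
    by (simp_all add: d_def e_def cmod_power2 add_pos_nonneg)
  have 1: "(cmod (1 + cnj z * w))\<^sup>2 + (cmod (z - w))\<^sup>2 = d * e"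
    unfolding d_def e_def cmod_power2 by (simp add: algebra_simps power2_eq_square)
  have 2: "(cmod (z - w))\<^sup>2 = d + e - 2 - 2 * (Re z * Re w + Im z * Im w)"
    unfolding d_def e_def cmod_power2 by (simp add: algebra_simps power2_eq_square)
  have "inv_stereo (Some z) \<bullet> inv_stereo (Some w) =
      (4 * (Re z * Re w + Im z * Im w) + (d - 2) * (e - 2)) / (d * e)"
    using d(1) e(1) unfolding inv_stereo_Some d_def[symmetric] e_def[symmetric]
    by (simp add: inner_vec_def sum_3) (simp add: field_simps)
  also have "4 * (Re z * Re w + Im z * Im w) + (d - 2) * (e - 2) = d * e - 2 * (cmod (z - w))\<^sup>2"
    unfolding 2 by (simp add: algebra_simps)
  also have "\<dots> = (cmod (1 + cnj z * w))\<^sup>2 - (cmod (z - w))\<^sup>2" using 1 by simp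
  finally show ?thesis by (simp add: 1)
qed

text \<open>Half of the angle is the arc tangent of \<open>cmod (z - w) / cmod (1 + cnj z * w)\<close>, and
  \<open>Re (1 + cnj z * w)\<close> is bounded below when both points lie in the same quadrant.\<close>

lemma ang_inv_stereo_le:
  assumes "0 < m" "m \<le> 1 + Re z * Re w + Im z * Im w"
  shows "ang (inv_stereo (Some z)) (inv_stereo (Some w)) \<le> 2 * (cmod (z - w) / m)"
proof -
  define M where "M = cmod (1 + cnj z * w)"
  define A where "A = cmod (z - w)"
  have M: "m \<le> M" using complex_Re_le_cmod[of "1 + cnj z * w"] assms(2) by (simp add: M_def)
  have M0: "M > 0" using M assms(1) by simp
  have A0: "A \<ge> 0" by (simp add: A_def)
  have pos: "1 + (A / M)\<^sup>2 > 0" by (simp add: add_pos_nonneg)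
  have "cos (2 * arctan (A / M)) = 2 / (1 + (A / M)\<^sup>2) - 1"
    using pos unfolding cos_double_cos cos_arctan by (simp add: power_divide)
  also have "\<dots> = (M\<^sup>2 - A\<^sup>2) / (M\<^sup>2 + A\<^sup>2)"
  proof -
    have "M\<^sup>2 + A\<^sup>2 > 0" using M0 by (simp add: add_pos_nonneg)
    then show ?thesis using M0 pos by (simp add: power_divide divide_simps)
  qed
  finally have "ang (inv_stereo (Some z)) (inv_stereo (Some w)) = arccos (cos (2 * arctan (A / M)))"
    by (simp add: ang_def inner_inv_stereo M_def A_def)
  also have "\<dots> = 2 * arctan (A / M)"
    using arctan_ubound[of "A / M"] A0 M0 by (intro arccos_cos) auto
  also have "\<dots> \<le> 2 * (A / M)" using arctan_le_self[of "A / M"] A0 M0 by simp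
  also have "\<dots> \<le> 2 * (A / m)" using A0 M assms(1) by (simp add: frac_le)
  finally show ?thesis by (simp add: A_def)
qed

lemma norm_diff_north_pole:
  "norm (inv_stereo (Some z) - north_pole) = 2 / sqrt (1 + (cmod z)\<^sup>2)"
proof -
  define d where "d = 1 + (cmod z)\<^sup>2"
  have d: "d > 0" by (simp add: d_def add_pos_nonneg)
  have ip: "inv_stereo (Some z) \<bullet> north_pole = 1 - 2 / d"
    by (simp add: inv_stereo_Some inner_vec_def sum_3 north_pole_def d_def)
  have "(norm (inv_stereo (Some z) - north_pole))\<^sup>2 = 2 - 2 * (inv_stereo (Some z) \<bullet> north_pole)"
    using norm_inv_stereo[of "Some z"] norm_inv_stereo[of None]
    unfolding power2_norm_eq_inner norm_eq_1 inv_stereo_None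
    by (simp add: inner_diff inner_commute[of north_pole "inv_stereo (Some z)"])
  also have "\<dots> = (2 / sqrt d)\<^sup>2" using d by (simp add: ip power_divide)
  finally have "norm (inv_stereo (Some z) - north_pole) = 2 / sqrt d"
    by (rule power2_eq_imp_eq) (use d in auto)
  then show ?thesis by (simp add: d_def)
qed

section \<open>Dyadic objects and the separation bound\<close>

lemma is_dyadic_Segment:
  assumes "is_dyadic (Segment a b)"
  shows "0 \<le> a" "a < b"
proof -
  have "0 \<le> a \<and> a < b"
    using assms
    by (induction "Segment a b" arbitrary: a b rule: is_dyadic.induct) (auto simp: midpoint_def)
  then show "0 \<le> a" "a < b" by auto
qed

abbreviation top_square :: dyadic where
  "top_square \<equiv> Square (Complex (-2) (-2)) (Complex 2 2)"

text \<open>Meant for a lower left corner \<open>a\<close> and an upper right corner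
  \<open>b\<close>, so that one sign per coordinate decides for the whole square.\<close>

definition in_quadrant :: "complex \<Rightarrow> complex \<Rightarrow> bool" where
  "in_quadrant a b \<longleftrightarrow> (0 \<le> Re a \<or> Re b \<le> 0) \<and> (0 \<le> Im a \<or> Im b \<le> 0)"

lemma midpoint_complex: "Re (midpoint a b) = (Re a + Re b) / 2" "Im (midpoint a b) = (Im a + Im b) / 2"
  by (simp_all add: midpoint_def)

text \<open>The first subdivision of the top square cuts along the axes, and later ones stay inside
  a quadrant.\<close>

lemma is_dyadic_Square:
  assumes "is_dyadic (Square a b)"
  shows "Re a < Re b" "Re b - Re a = Im b - Im a" "Square a b = top_square \<or> in_quadrant a b"
proof -
  have "Re a < Re b \<and> Re b - Re a = Im b - Im a \<and> (Square a b = top_square \<or> in_quadrant a b)"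
    using assms
  proof (induction "Square a b" arbitrary: a b rule: is_dyadic.induct)
  qed (auto simp: midpoint_complex in_quadrant_def, argo+)
  then show "Re a < Re b" "Re b - Re a = Im b - Im a" "Square a b = top_square \<or> in_quadrant a b"
    by auto
qed

lemma Inf_abs_image:
  fixes f :: "'a \<Rightarrow> real"
  assumes "f ` S = {u..v}" "u \<le> v" "0 \<le> u \<or> v \<le> 0"
  shows "(INF z\<in>S. \<bar>f z\<bar>) = min \<bar>u\<bar> \<bar>v\<bar>"
proof -
  have "(\<lambda>z. \<bar>f z\<bar>) ` S = abs ` {u..v}" unfolding assms(1)[symmetric] image_image ..
  moreover have "Inf (abs ` {u..v}) = min \<bar>u\<bar> \<bar>v\<bar>"
    using assms(2,3) by (intro cInf_eq_minimum) (auto simp: min_def)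
  ultimately show ?thesis by simp
qed

lemma Sup_abs_image:
  fixes f :: "'a \<Rightarrow> real"
  assumes "f ` S = {u..v}" "u \<le> v"
  shows "(SUP z\<in>S. \<bar>f z\<bar>) = max \<bar>u\<bar> \<bar>v\<bar>"
proof -
  have "(\<lambda>z. \<bar>f z\<bar>) ` S = abs ` {u..v}" unfolding assms(1)[symmetric] image_image ..
  moreover have "Sup (abs ` {u..v}) = max \<bar>u\<bar> \<bar>v\<bar>"
    using assms(2) by (intro cSup_eq_maximum) (auto simp: max_def intro: rev_image_eqI)
  ultimately show ?thesis by simp
qed

lemma image_cbox_complex:
  assumes "Re a \<le> Re b" "Im a \<le> Im b"
  shows "Re ` cbox a b = {Re a..Re b}" "Im ` cbox a b = {Im a..Im b}"
proof -
  have "x \<in> Re ` cbox a b" if "x \<in> {Re a..Re b}" for x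
    using that assms by (intro image_eqI[of _ _ "Complex x (Im a)"]) (auto simp: in_cbox_complex_iff)
  moreover have "x \<in> Im ` cbox a b" if "x \<in> {Im a..Im b}" for x
    using that assms by (intro image_eqI[of _ _ "Complex (Re a) x"]) (auto simp: in_cbox_complex_iff)
  ultimately show "Re ` cbox a b = {Re a..Re b}" "Im ` cbox a b = {Im a..Im b}"
    by (auto simp: in_cbox_complex_iff)
qed

lemma Segment_bounds:
  assumes "0 \<le> a" "a \<le> b"
  shows "x_min (Segment a b) = a" "x_max (Segment a b) = b" "y_min (Segment a b) = 0"
    "y_max (Segment a b) = 0"
proof -
  have "Re ` complex_of_real ` {a..b} = {a..b}" "Im ` complex_of_real ` {a..b} = {0..0}"
    using assms by (auto simp: image_image)
  then show "x_min (Segment a b) = a" "x_max (Segment a b) = b" "y_min (Segment a b) = 0"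
    "y_max (Segment a b) = 0"
    using assms Inf_abs_image[of Re _ a b] Inf_abs_image[of Im _ 0 0]
      Sup_abs_image[of Re _ a b] Sup_abs_image[of Im _ 0 0]
    unfolding x_min_def x_max_def y_min_def y_max_def plane_points.simps by simp_all
qed

lemma Square_max:
  assumes "Re a \<le> Re b" "Im a \<le> Im b"
  shows "x_max (Square a b) = max \<bar>Re a\<bar> \<bar>Re b\<bar>" "y_max (Square a b) = max \<bar>Im a\<bar> \<bar>Im b\<bar>"
  using assms by (simp_all add: x_max_def y_max_def Sup_abs_image image_cbox_complex)

lemma Square_min:
  assumes "Re a \<le> Re b" "Im a \<le> Im b" "in_quadrant a b"
  shows "x_min (Square a b) = min \<bar>Re a\<bar> \<bar>Re b\<bar>" "y_min (Square a b) = min \<bar>Im a\<bar> \<bar>Im b\<bar>"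
  using assms by (simp_all add: x_min_def y_min_def Inf_abs_image image_cbox_complex in_quadrant_def)

text \<open>The square $[-2,2]^2$ is the only dyadic square that crosses the coordinate axes, and its
  separation bound from infinity is $0$.\<close>

definition proper :: "dyadic \<Rightarrow> bool" where
  "proper Q \<longleftrightarrow> is_dyadic Q \<and> Q \<noteq> Infinity \<and> Q \<noteq> top_square"

lemma proper_cases:
  assumes "proper Q"
  obtains (segment) a b where "Q = Segment a b" "0 \<le> a" "a < b" "delta Q = 2 * (b - a) / (1 + a\<^sup>2)"
  | (square) a b where "Q = Square a b" "Re a < Re b" "Re b - Re a = Im b - Im a" "in_quadrant a b"
      "delta Q = 2 * (Re b - Re a) / (1 + (x_min Q)\<^sup>2 + (y_min Q)\<^sup>2)"
proof (cases Q)
  case (Segment a b)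
  then have ab: "0 \<le> a" "a < b" using assms is_dyadic_Segment by (auto simp: proper_def)
  show ?thesis by (rule segment[OF Segment ab]) (use ab in \<open>simp add: Segment delta_def Segment_bounds\<close>)
next
  case (Square a b)
  then have ab: "Re a < Re b" "Re b - Re a = Im b - Im a" "in_quadrant a b"
    using assms is_dyadic_Square[of a b] by (auto simp: proper_def)
  \<comment> \<open>The square lies on one side of the imaginary axis, so taking absolute values
    preserves the length of the range of \<open>Re\<close>.\<close>
  have "x_max Q - x_min Q = Re b - Re a"
    using ab unfolding Square by (auto simp: Square_max Square_min in_quadrant_def)
  then show ?thesis by (intro square[OF Square ab]) (simp add: Square delta_def)
qed (use assms in \<open>simp add: proper_def\<close>)

lemma proper_abs_bounds:
  assumes "proper Q" "z \<in> plane_points Q"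
  shows "0 \<le> x_min Q" "x_min Q \<le> \<bar>Re z\<bar>" "\<bar>Re z\<bar> \<le> x_max Q"
    "0 \<le> y_min Q" "y_min Q \<le> \<bar>Im z\<bar>" "\<bar>Im z\<bar> \<le> y_max Q"
proof -
  have "0 \<le> x_min Q \<and> x_min Q \<le> \<bar>Re z\<bar> \<and> \<bar>Re z\<bar> \<le> x_max Q \<and>
    0 \<le> y_min Q \<and> y_min Q \<le> \<bar>Im z\<bar> \<and> \<bar>Im z\<bar> \<le> y_max Q"
    using assms(1)
  proof (cases rule: proper_cases)
    case (segment a b)
    then show ?thesis using assms(2) by (auto simp: Segment_bounds)
  next
    case (square a b)
    then show ?thesis using assms(2)
      by (auto simp: Square_max Square_min in_cbox_complex_iff in_quadrant_def)
  qed
  then show "0 \<le> x_min Q" "x_min Q \<le> \<bar>Re z\<bar>" "\<bar>Re z\<bar> \<le> x_max Q"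
    "0 \<le> y_min Q" "y_min Q \<le> \<bar>Im z\<bar>" "\<bar>Im z\<bar> \<le> y_max Q" by auto
qed

text \<open>Within one quadrant, products of coordinates equal the products of their absolute
  values. The bound serves for the angle to the center and, with z = w, for the conformal
  factor.\<close>

lemma proper_inner_ge:
  assumes "proper Q" "z \<in> plane_points Q" "w \<in> plane_points Q"
  shows "(x_min Q)\<^sup>2 + (y_min Q)\<^sup>2 \<le> Re z * Re w + Im z * Im w"
proof -
  have "Re z * Re w = \<bar>Re z\<bar> * \<bar>Re w\<bar> \<and> Im z * Im w = \<bar>Im z\<bar> * \<bar>Im w\<bar>"
    using assms(1)
  proof (cases rule: proper_cases)
    case (segment a b)
    then show ?thesis using assms(2,3) by auto
  next
    case (square a b)
    then have "0 \<le> Re z \<and> 0 \<le> Re w \<or> Re z \<le> 0 \<and> Re w \<le> 0" "0 \<le> Im z \<and> 0 \<le> Im w \<or> Im z \<le> 0 \<and> Im w \<le> 0"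
      using assms(2,3) by (auto simp: in_cbox_complex_iff in_quadrant_def)
    then show ?thesis by (auto simp: abs_mult[symmetric] zero_le_mult_iff)
  qed
  then show ?thesis
    using proper_abs_bounds[OF assms(1,2)] proper_abs_bounds[OF assms(1,3)]
    by (auto simp: power2_eq_square intro!: add_mono mult_mono)
qed

text \<open>A point is at distance at most half a side times \<open>tau\<close> from the center, and
  \<open>delta\<close> is twice the side divided by m.\<close>

lemma proper_ang_center_le:
  assumes "proper Q" "p \<in> points Q"
  shows "ang (inv_stereo p) (inv_stereo (center Q)) \<le> 2 * (delta Q * tau Q / 4)"
proof -
  obtain z where z: "p = Some z" "z \<in> plane_points Q"
    using assms by (auto simp: points_def proper_def)
  define m where "m = 1 + (x_min Q)\<^sup>2 + (y_min Q)\<^sup>2"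
  have m: "m > 0" by (simp add: m_def add_pos_nonneg)
  have "\<exists>c. center Q = Some c \<and> c \<in> plane_points Q \<and> cmod (z - c) / m \<le> delta Q * tau Q / 4"
    using assms(1)
  proof (cases rule: proper_cases)
    case (segment a b)
    define c where "c = (a + b) / 2"
    have "center Q = Some (complex_of_real c)"
      using segment by (simp add: c_def midpoint_def field_simps)
    moreover have "complex_of_real c \<in> plane_points Q" unfolding segment(1) plane_points.simps
      by (rule imageI) (use segment in \<open>simp add: c_def\<close>)
    moreover have "cmod (z - c) \<le> (b - a) / 2"
    proof -
      obtain t where t: "t \<in> {a..b}" "z = of_real t" using z(2) segment by auto
      have "cmod (z - c) = \<bar>t - c\<bar>" unfolding t(2) by (simp flip: of_real_diff)
      moreover have "\<bar>t - c\<bar> \<le> (b - a) / 2"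
        using t(1) by (auto simp: c_def abs_le_iff field_simps)
      ultimately show ?thesis by simp
    qed
    then have "cmod (z - c) / m \<le> delta Q * tau Q / 4"
      using m segment by (simp add: Segment_bounds m_def divide_simps)
    ultimately show ?thesis by blast
  next
    case (square a b)
    define c where "c = midpoint a b"
    have c: "Re c = (Re a + Re b) / 2" "Im c = (Im a + Im b) / 2"
      by (simp_all add: c_def midpoint_complex)
    have "c \<in> plane_points Q" using square by (auto simp: c in_cbox_complex_iff)
    have "cmod (z - c) \<le> (Re b - Re a) / 2 * sqrt 2"
    proof -
      have "z \<in> cbox a b" using z(2) square by simp
      then have "\<bar>Re (z - c)\<bar> \<le> (Re b - Re a) / 2" "\<bar>Im (z - c)\<bar> \<le> (Re b - Re a) / 2"
        using square(3) by (auto simp: in_cbox_complex_iff c abs_le_iff field_simps)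
      then have "(Re (z - c))\<^sup>2 + (Im (z - c))\<^sup>2 \<le> ((Re b - Re a) / 2)\<^sup>2 + ((Re b - Re a) / 2)\<^sup>2"
        by (intro add_mono) (simp_all add: abs_le_square_iff[symmetric])
      also have "\<dots> = ((Re b - Re a) / 2 * sqrt 2)\<^sup>2" by (simp add: power_mult_distrib power_divide)
      finally have "(cmod (z - c))\<^sup>2 \<le> ((Re b - Re a) / 2 * sqrt 2)\<^sup>2" by (simp only: cmod_power2)
      then show ?thesis by (rule power2_le_imp_le) (use square(2) in simp)
    qed
    moreover have "delta Q * tau Q / 4 = (Re b - Re a) / 2 * sqrt 2 / m"
    proof -
      have "tau Q = sqrt 2" by (simp add: square(1))
      moreover have "2 * s / m * t / 4 = s / 2 * t / m" for s t :: real by simp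
      ultimately show ?thesis by (simp only: square(5)[folded m_def])
    qed
    ultimately have "cmod (z - c) / m \<le> delta Q * tau Q / 4"
      using divide_right_mono[of _ _ m] m by (metis less_imp_le)
    with \<open>c \<in> plane_points Q\<close> show ?thesis using square(1) by (auto simp: c_def)
  qed
  then obtain c where c: "center Q = Some c" "c \<in> plane_points Q" "cmod (z - c) / m \<le> delta Q * tau Q / 4"
    by blast
  have "m \<le> 1 + Re z * Re c + Im z * Im c"
    using proper_inner_ge[OF assms(1) z(2) c(2)] by (simp add: m_def)
  from ang_inv_stereo_le[OF m this]
  have "ang (inv_stereo p) (inv_stereo (center Q)) \<le> 2 * (cmod (z - c) / m)"
    by (simp only: z(1) c(1))
  also have "\<dots> \<le> 2 * (delta Q * tau Q / 4)"
    using c(3) by (intro mult_left_mono) simp_all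
  finally show ?thesis .
qed

section \<open>The separation bound\<close>

lemma Infinity_ang_center: "p \<in> points Infinity \<Longrightarrow> ang (inv_stereo p) (inv_stereo (center Infinity)) = 0"
  using norm_inv_stereo[of None, unfolded norm_eq_1] by (simp add: ang_def points_def)

text \<open>The distance to the north pole decreases with the modulus, and some vertex dominates
  every point in both coordinates.\<close>

lemma vertex_far:
  assumes "proper Q" "p \<in> points Q"
  shows "\<exists>v\<in>vertices Q. norm (inv_stereo v - north_pole) \<le> norm (inv_stereo p - north_pole)"
proof -
  obtain z where z: "p = Some z" "z \<in> plane_points Q"
    using assms by (auto simp: points_def proper_def)
  have "\<exists>v. Some v \<in> vertices Q \<and> \<bar>Re z\<bar> \<le> \<bar>Re v\<bar> \<and> \<bar>Im z\<bar> \<le> \<bar>Im v\<bar>"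
    using assms(1)
  proof (cases rule: proper_cases)
    case (segment a b)
    then show ?thesis using z(2) by (intro exI[of _ "complex_of_real b"]) auto
  next
    case (square a b)
    define v where "v = Complex (if 0 \<le> Re a then Re b else Re a) (if 0 \<le> Im a then Im b else Im a)"
    have "Some v \<in> vertices Q" using square by (auto simp: v_def)
    moreover have "\<bar>Re z\<bar> \<le> \<bar>Re v\<bar>" "\<bar>Im z\<bar> \<le> \<bar>Im v\<bar>"
      using square z(2) by (auto simp: v_def in_cbox_complex_iff in_quadrant_def)
    ultimately show ?thesis by blast
  qed
  then obtain v where v: "Some v \<in> vertices Q" "\<bar>Re z\<bar> \<le> \<bar>Re v\<bar>" "\<bar>Im z\<bar> \<le> \<bar>Im v\<bar>" by blast
  have "(cmod z)\<^sup>2 \<le> (cmod v)\<^sup>2"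
    using v by (auto simp: cmod_power2 abs_le_square_iff intro!: add_mono)
  then have "2 / sqrt (1 + (cmod v)\<^sup>2) \<le> 2 / sqrt (1 + (cmod z)\<^sup>2)"
    by (intro divide_left_mono) (auto simp: add_pos_nonneg)
  then show ?thesis using v(1) z by (intro bexI[of _ "Some v"]) (simp_all add: norm_diff_north_pole)
qed

lemma finite_vertices [simp]: "finite (vertices Q)"
  and vertices_nonempty [simp]: "vertices Q \<noteq> {}"
  by (cases Q; simp)+

lemma psi_min_le_chord:
  assumes "proper Q" "proper Q' \<or> Q' = Infinity" "p \<in> points Q" "q \<in> points Q'"
  shows "psi_min Q Q' \<le> chord p q"
proof -
  have "2 * (delta Q' * tau Q' / 4) \<ge> ang (inv_stereo q) (inv_stereo (center Q'))"
    using assms(2,4) proper_ang_center_le Infinity_ang_center[of q] by auto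
  from norm_diff_ge_of_ang_le[OF _ _ _ _ proper_ang_center_le[OF assms(1,3)] this]
  have "chord (center Q) (center Q') * (1 - ((delta Q * tau Q + delta Q' * tau Q') / 4)\<^sup>2 / 2)
      - sqrt (4 - (chord (center Q) (center Q'))\<^sup>2) * ((delta Q * tau Q + delta Q' * tau Q') / 4)
      \<le> chord p q"
    by (simp add: chord_def add_divide_distrib)
  moreover have "(MIN v\<in>vertices Q. norm (inv_stereo v - north_pole)) \<le> chord p q" if "Q' = Infinity"
  proof -
    obtain v where "v \<in> vertices Q" "norm (inv_stereo v - north_pole) \<le> norm (inv_stereo p - north_pole)"
      using vertex_far[OF assms(1,3)] by blast
    moreover have "chord p q = norm (inv_stereo p - north_pole)"
      using that assms(4) by (simp add: chord_def points_def inv_stereo_None)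
    ultimately show ?thesis by (auto intro: Min.coboundedI order_trans simp: Min_le_iff)
  qed
  ultimately show ?thesis
    unfolding psi_min_def Let_def by (auto simp: chord_def)
qed

lemma delta_top_square: "delta top_square = 4"
proof -
  have "Re ` cbox (Complex (-2) (-2)) (Complex 2 2) = {-2..2}"
    "Im ` cbox (Complex (-2) (-2)) (Complex 2 2) = {-2..2}"
    by (simp_all add: image_cbox_complex)
  then have mx: "x_max top_square = 2" unfolding x_max_def by (simp add: Sup_abs_image)
  have z: "(0::complex) \<in> cbox (Complex (-2) (-2)) (Complex 2 2)" by (simp add: in_cbox_complex_iff)
  have "x_min top_square = 0" "y_min top_square = 0"
    unfolding x_min_def y_min_def using z by (auto intro!: cInf_eq_minimum image_eqI[of _ _ 0])
  then show ?thesis by (simp add: delta_def mx)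
qed

text \<open>Here the quantity \<open>d\<close> is exactly sqrt 2, so the factor 1 - d^2/2 vanishes
  and the second candidate is at most 0. The third is absent because the square crosses the
  axes.\<close>

lemma psi_min_top_square: "psi_min top_square Infinity = 0"
proof -
  define D where "D = chord (center top_square) None"
  have "D \<le> 2"
    unfolding D_def chord_def
    using norm_triangle_ineq4[of "inv_stereo (center top_square)" "inv_stereo None"] by simp
  moreover have "D \<ge> 0" by (simp add: D_def chord_def)
  ultimately have "D\<^sup>2 \<le> 2\<^sup>2" by (intro power_mono)
  then have "- (sqrt (4 - D\<^sup>2) * sqrt 2) \<le> 0" by simp
  moreover have "\<not> normal_dyadic top_square"
  proof -
    let ?a = "Complex (-2) (-2)" and ?b = "Complex 2 2"
    have "?a \<in> cbox ?a ?b" "?b \<in> cbox ?a ?b" by (simp_all add: in_cbox_complex_iff)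
    moreover have "\<not> 0 \<le> Re ?a" "\<not> Re ?b \<le> 0" by simp_all
    ultimately show ?thesis unfolding normal_dyadic.simps by blast
  qed
  moreover have "delta top_square * tau top_square + delta Infinity * tau Infinity = 4 * sqrt 2"
    by (simp add: delta_top_square)
  ultimately show ?thesis
    unfolding psi_min_def Let_def center.simps(3) D_def[symmetric]
    by (simp del: normal_dyadic.simps)
qed

section \<open>Moving points to vertices\<close>

lemma vertices_subset_points:
  assumes "proper Q \<or> Q = Infinity"
  shows "vertices Q \<subseteq> points Q"
proof (cases "Q = Infinity")
  case False
  then have "proper Q" using assms by simp
  then show ?thesis
    by (cases rule: proper_cases) (auto simp: points_def in_cbox_complex_iff)
qed (simp add: points_def)

text \<open>The finite branch of \<open>err_eps\<close>, as a real number and with the separation as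
  a parameter.\<close>

definition pair_error :: "(real \<Rightarrow> real) \<Rightarrow> dyadic \<Rightarrow> real \<Rightarrow> real" where
  "pair_error E Q R = max 0 (Lambda1 E Q R) + Lambda2 E Q R"

lemma pair_error_Segment:
  "pair_error E (Segment a b) R = (nonneg_bend E R - deriv E R) / 8"
  by (simp add: pair_error_def nonneg_bend_def max_def field_simps)

lemma pair_error_Square:
  assumes "deriv E R \<le> 0"
  shows "(2 * nonneg_bend E R - (sqrt (1 + (x_max (Square a b))\<^sup>2) + sqrt (1 + (y_max (Square a b))\<^sup>2)) * deriv E R) / 8
    \<le> pair_error E (Square a b) R"
proof -
  define K where "K = sqrt (1 + (x_max (Square a b))\<^sup>2) + sqrt (1 + (y_max (Square a b))\<^sup>2)"
  have "- deriv E R * K \<ge> 0" using assms by (simp add: K_def mult_nonpos_nonneg)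
  \<comment> \<open>The two moves cost 1/8 in front of E'; the constant 7.98 of
    \<open>Lambda2\<close> only enlarges this nonnegative term.\<close>
  then have "- deriv E R * K / 8 \<le> - deriv E R * K / 7.98" by (simp add: field_simps)
  then show ?thesis
    by (simp add: pair_error_def nonneg_bend_def max_def field_simps flip: K_def)
qed

text \<open>The real axis is the line with c = 0, whose image is a great circle of curvature 1, and
  1 + a^2 is the least value of 1 + x^2 on the segment.\<close>

lemma vertex_energy_le_Segment:
  fixes q :: "'j \<Rightarrow> real^3"
  assumes E: "admissible E" and Q: "proper (Segment a b)" and z: "z \<in> points (Segment a b)"
    and q: "\<And>j. j \<in> J \<Longrightarrow> norm (q j) = 1"
    and R: "\<And>j. j \<in> J \<Longrightarrow> 0 < R j"
      "\<And>j p. j \<in> J \<Longrightarrow> p \<in> points (Segment a b) \<Longrightarrow> R j \<le> norm (inv_stereo p - q j)"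
  shows "\<exists>v\<in>vertices (Segment a b).
    (\<Sum>j\<in>J. E (norm (inv_stereo v - q j))) \<le> (\<Sum>j\<in>J. E (norm (inv_stereo z - q j)))
      + (\<Sum>j\<in>J. pair_error E (Segment a b) (R j) * (delta (Segment a b))\<^sup>2)"
proof -
  have ab: "0 \<le> a" "a < b" "delta (Segment a b) = 2 * (b - a) / (1 + a\<^sup>2)"
    using Q by (auto elim: proper_cases)
  obtain x where x: "x \<in> {a..b}" "z = Some (Complex x 0)"
    using z by (auto simp: points_def complex_of_real_def)
  define p where "p x = inv_stereo (Some (Complex x 0))" for x
  have "\<exists>x'\<in>{a, b}. (\<Sum>j\<in>J. E (norm (p x' - q j))) \<le> (\<Sum>j\<in>J. E (norm (p x - q j)))
     + (\<Sum>j\<in>J. (2 * (b - a) / (1 + a\<^sup>2))\<^sup>2 / 8 * (nonneg_bend E (R j) - sqrt (1 + 0\<^sup>2) * deriv E (R j)))"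
  proof (rule endpoint_energy_le[OF E orthonormal_frame_axis(1)])
    show "p \<xi> = line_arc (axis 1 1) (axis 2 1) 0 (arc_param 0 \<xi>)" for \<xi>
      by (simp add: p_def inv_stereo_eq_line_arc(1))
    show "1 + a\<^sup>2 \<le> 1 + 0\<^sup>2 + \<xi>\<^sup>2" if "\<xi> \<in> {a..b}" for \<xi>
      using that ab by (simp add: power_mono)
    show "R j \<le> norm (p \<xi> - q j)" if "j \<in> J" "\<xi> \<in> {a..b}" for j \<xi>
      unfolding p_def using that by (intro R) (auto simp: points_def complex_of_real_def)
  qed (use ab x q R in \<open>auto simp: add_pos_nonneg\<close>)
  then show ?thesis
    by (auto simp: p_def x(2) ab(3) pair_error_Segment complex_of_real_def mult_ac)
qed

text \<open>After the horizontal move at height y the point is on a vertical side x', inside the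
  square, so the same separation bounds apply to the vertical move. Equal sides give both moves the
  same \<open>delta\<close>; their curvatures are sqrt(1 + y^2) and sqrt(1 + x'^2).\<close>

lemma vertex_energy_le_Square:
  fixes q :: "'j \<Rightarrow> real^3"
  assumes E: "admissible E" and Q: "proper (Square a b)" and z: "z \<in> points (Square a b)"
    and q: "\<And>j. j \<in> J \<Longrightarrow> norm (q j) = 1"
    and R: "\<And>j. j \<in> J \<Longrightarrow> 0 < R j"
      "\<And>j p. j \<in> J \<Longrightarrow> p \<in> points (Square a b) \<Longrightarrow> R j \<le> norm (inv_stereo p - q j)"
  shows "\<exists>v\<in>vertices (Square a b).
    (\<Sum>j\<in>J. E (norm (inv_stereo v - q j))) \<le> (\<Sum>j\<in>J. E (norm (inv_stereo z - q j)))
      + (\<Sum>j\<in>J. pair_error E (Square a b) (R j) * (delta (Square a b))\<^sup>2)"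
proof -
  let ?Q = "Square a b"
  define m where "m = 1 + (x_min ?Q)\<^sup>2 + (y_min ?Q)\<^sup>2"
  have m: "m > 0" by (simp add: m_def add_pos_nonneg)
  have ab: "Re a < Re b" "Re b - Re a = Im b - Im a" "delta ?Q = 2 * (Re b - Re a) / m"
    using Q by (auto simp: m_def elim: proper_cases)
  define S where "S w = (\<Sum>j\<in>J. E (norm (inv_stereo (Some w) - q j)))" for w
  define err where "err c = (\<Sum>j\<in>J. (delta ?Q)\<^sup>2 / 8 * (nonneg_bend E (R j) - sqrt (1 + c\<^sup>2) * deriv E (R j)))" for c
  obtain x y where xy: "x \<in> {Re a..Re b}" "y \<in> {Im a..Im b}" "z = Some (Complex x y)"
    using z by (auto simp: points_def in_cbox_complex_iff)
  have in_Q: "Some (Complex \<xi> \<eta>) \<in> points ?Q" "m \<le> 1 + \<xi>\<^sup>2 + \<eta>\<^sup>2" "\<bar>\<xi>\<bar> \<le> x_max ?Q" "\<bar>\<eta>\<bar> \<le> y_max ?Q"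
    if "\<xi> \<in> {Re a..Re b}" "\<eta> \<in> {Im a..Im b}" for \<xi> \<eta>
  proof -
    have pt: "Complex \<xi> \<eta> \<in> plane_points ?Q" using that by (simp add: in_cbox_complex_iff)
    then show "Some (Complex \<xi> \<eta>) \<in> points ?Q" by (simp add: points_def)
    show "\<bar>\<xi>\<bar> \<le> x_max ?Q" "\<bar>\<eta>\<bar> \<le> y_max ?Q" using proper_abs_bounds[OF Q pt] by simp_all
    show "m \<le> 1 + \<xi>\<^sup>2 + \<eta>\<^sup>2"
      using proper_inner_ge[OF Q pt pt] by (simp add: m_def power2_eq_square)
  qed
  have "\<exists>x'\<in>{Re a, Re b}. S (Complex x' y) \<le> S (Complex x y) + err y"
    unfolding S_def err_def ab(3)
  proof (rule endpoint_energy_le[OF E orthonormal_frame_axis(1) inv_stereo_eq_line_arc(1)])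
    show "m \<le> 1 + y\<^sup>2 + \<xi>\<^sup>2" if "\<xi> \<in> {Re a..Re b}" for \<xi>
      using in_Q(2)[OF that xy(2)] by simp
    show "R j \<le> norm (inv_stereo (Some (Complex \<xi> y)) - q j)" if "j \<in> J" "\<xi> \<in> {Re a..Re b}" for j \<xi>
      using that xy by (intro R in_Q)
  qed (use ab(1) m xy q R in auto)
  then obtain x' where x': "x' \<in> {Re a, Re b}" "S (Complex x' y) \<le> S (Complex x y) + err y" by blast
  then have x'_in: "x' \<in> {Re a..Re b}" using ab(1) by auto
  have "\<exists>y'\<in>{Im a, Im b}. S (Complex x' y') \<le> S (Complex x' y) + err x'"
    unfolding S_def err_def ab(3) ab(2)
  proof (rule endpoint_energy_le[OF E orthonormal_frame_axis(2) inv_stereo_eq_line_arc(2)])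
    show "m \<le> 1 + x'\<^sup>2 + \<eta>\<^sup>2" if "\<eta> \<in> {Im a..Im b}" for \<eta>
      using in_Q(2)[OF x'_in that] .
    show "R j \<le> norm (inv_stereo (Some (Complex x' \<eta>)) - q j)" if "j \<in> J" "\<eta> \<in> {Im a..Im b}" for j \<eta>
      using that x'_in by (intro R in_Q)
  qed (use ab(1,2) m xy q R in auto)
  then obtain y' where y': "y' \<in> {Im a, Im b}" "S (Complex x' y') \<le> S (Complex x' y) + err x'" by blast
  have "err y + err x' \<le> (\<Sum>j\<in>J. pair_error E ?Q (R j) * (delta ?Q)\<^sup>2)"
    unfolding err_def sum.distrib[symmetric]
  proof (rule sum_mono)
    fix j assume "j \<in> J"
    define A B where "A = deriv E (R j)" and "B = nonneg_bend E (R j)"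
    have A: "A \<le> 0" using admissible_deriv_nonpos[OF E R(1)] \<open>j \<in> J\<close> by (simp add: A_def)
    have "sqrt (1 + x'\<^sup>2) + sqrt (1 + y\<^sup>2) \<le> sqrt (1 + (x_max ?Q)\<^sup>2) + sqrt (1 + (y_max ?Q)\<^sup>2)"
      using in_Q(3,4)[OF x'_in xy(2)]
      by (intro add_mono real_sqrt_le_mono) (auto simp: abs_le_square_iff[symmetric])
    from mult_right_mono_neg[OF this A]
    have "(B - sqrt (1 + y\<^sup>2) * A + (B - sqrt (1 + x'\<^sup>2) * A)) / 8 \<le> pair_error E ?Q (R j)"
      using pair_error_Square[of E "R j" a b] A unfolding A_def B_def
      by (simp add: algebra_simps)
    from mult_right_mono[OF this zero_le_power2[of "delta ?Q"]]
    show "(delta ?Q)\<^sup>2 / 8 * (B - sqrt (1 + y\<^sup>2) * A) + (delta ?Q)\<^sup>2 / 8 * (B - sqrt (1 + x'\<^sup>2) * A)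
        \<le> pair_error E ?Q (R j) * (delta ?Q)\<^sup>2"
      by (simp add: algebra_simps add_divide_distrib diff_divide_distrib)
  qed
  then have "S (Complex x' y') \<le> S (Complex x y) + (\<Sum>j\<in>J. pair_error E ?Q (R j) * (delta ?Q)\<^sup>2)"
    using x'(2) y'(2) by linarith
  moreover have "Some (Complex x' y') \<in> vertices ?Q"
    using x'(1) y'(1) by (auto simp: complex_eq_iff)
  ultimately show ?thesis unfolding S_def xy(3) by blast
qed

lemma vertex_energy_le:
  fixes q :: "'j \<Rightarrow> real^3"
  assumes "admissible E" "proper Q" "z \<in> points Q"
    and "\<And>j. j \<in> J \<Longrightarrow> norm (q j) = 1"
    and "\<And>j. j \<in> J \<Longrightarrow> 0 < R j"
      "\<And>j p. j \<in> J \<Longrightarrow> p \<in> points Q \<Longrightarrow> R j \<le> norm (inv_stereo p - q j)"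
  shows "\<exists>v\<in>vertices Q.
    (\<Sum>j\<in>J. E (norm (inv_stereo v - q j))) \<le> (\<Sum>j\<in>J. E (norm (inv_stereo z - q j)))
      + (\<Sum>j\<in>J. pair_error E Q (R j) * (delta Q)\<^sup>2)"
  using vertex_energy_le_Segment[of E _ _ z J q R] vertex_energy_le_Square[of E _ _ z J q R] assms
  by (cases Q) (auto simp: proper_def)

section \<open>One point moved at a time, and the bound for a block\<close>

lemma chord_commute: "chord v w = chord w v"
  by (simp add: chord_def norm_minus_commute)

lemma energy_fun_upd:
  assumes "i \<le> n"
  shows "energy E n (z(i := v)) - energy E n z =
    (\<Sum>j\<in>{..n} - {i}. E (chord v (z j))) - (\<Sum>j\<in>{..n} - {i}. E (chord (z i) (z j)))"
proof -
  define d where "d j = E (chord v (z j)) - E (chord (z i) (z j))" for j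
  let ?z = "z(i := v)"
  have "energy E n ?z - energy E n z
      = (\<Sum>j\<le>n. \<Sum>k<j. E (chord (?z k) (?z j)) - E (chord (z k) (z j)))"
    by (simp add: energy_def sum_subtractf)
  \<comment> \<open>Index i is the larger index of a pair in row j = i and the smaller one in the
    rows j > i; all other pairs cancel.\<close>
  also have "\<dots> = (\<Sum>j\<le>n. (if j = i then \<Sum>k<i. d k else 0) + (if i < j then d j else 0))"
  proof (rule sum.cong[OF refl])
    fix j assume "j \<in> {..n}"
    show "(\<Sum>k<j. E (chord (?z k) (?z j)) - E (chord (z k) (z j)))
        = (if j = i then \<Sum>k<i. d k else 0) + (if i < j then d j else 0)"
    proof (cases "j = i")
      case True
      then show ?thesis by (auto simp: d_def chord_commute intro!: sum.cong)
    next
      case False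
      then have "(\<Sum>k<j. E (chord (?z k) (?z j)) - E (chord (z k) (z j)))
          = (\<Sum>k<j. if k = i then d j else 0)"
        by (intro sum.cong) (auto simp: d_def)
      then show ?thesis using False by (simp add: sum.delta)
    qed
  qed
  also have "\<dots> = (\<Sum>k<i. d k) + (\<Sum>j\<in>{i<..n}. d j)"
  proof -
    have "{..n} \<inter> {j. i < j} = {i<..n}" by auto
    then have "(\<Sum>j\<le>n. if i < j then d j else 0) = (\<Sum>j\<in>{i<..n}. d j)"
      using sum.inter_restrict[of "{..n}" d "{j. i < j}"] by simp
    then show ?thesis using assms by (simp add: sum.distrib sum.delta)
  qed
  also have "\<dots> = (\<Sum>j\<in>{..n} - {i}. d j)"
  proof -
    have "{..n} - {i} = {..<i} \<union> {i<..n}" using assms by auto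
    moreover have "{..<i} \<inter> {i<..n} = {}" by auto
    ultimately show ?thesis by (simp add: sum.union_disjoint)
  qed
  finally show ?thesis by (simp add: d_def sum_subtractf)
qed

theorem theorem5p1:
  fixes n :: nat and Q :: "nat \<Rightarrow> dyadic" and E :: "real \<Rightarrow> real"
  assumes "n \<ge> 1"
    and "block n Q"
    and "admissible E"
  shows "ereal (ERR E n Q) \<le>
    (\<Sum>i<n. \<Sum>j\<in>{..n} - {i}. err_eps E (Q i) (Q j) * ereal ((delta (Q i))\<^sup>2))"
proof (cases "\<exists>i<n. \<exists>j\<in>{..n} - {i}. psi_min (Q i) (Q j) = 0")
  case True
  then obtain i j where ij: "i < n" "j \<in> {..n} - {i}" "psi_min (Q i) (Q j) = 0" by blast
  \<comment> \<open>In \<open>ereal\<close> infinity times 0 is 0, so the summand is infinite only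
    because \<open>delta\<close> is nonzero.\<close>
  have "delta (Q i) \<noteq> 0"
  proof (cases "Q i = top_square")
    case True
    then show ?thesis using delta_top_square by simp
  next
    case False
    then have "proper (Q i)" using assms(2) ij(1) by (auto simp: block_def proper_def)
    then show ?thesis
      by (cases rule: proper_cases) (auto simp: add_pos_nonneg add_nonneg_eq_0_iff)
  qed
  then have "err_eps E (Q i) (Q j) * ereal ((delta (Q i))\<^sup>2) = \<infinity>"
    using ij(3) by (simp add: err_eps_def)
  then have "(\<Sum>j\<in>{..n} - {i}. err_eps E (Q i) (Q j) * ereal ((delta (Q i))\<^sup>2)) = \<infinity>"
    unfolding sum_Pinfty using ij(2) by blast
  then have "(\<Sum>i<n. \<Sum>j\<in>{..n} - {i}. err_eps E (Q i) (Q j) * ereal ((delta (Q i))\<^sup>2)) = \<infinity>"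
    unfolding sum_Pinfty[of _ "{..<n}"] using ij(1) by blast
  then show ?thesis by simp
next
  case False
  define R where "R i j = psi_min (Q i) (Q j)" for i j
  have R: "R i j > 0" if "i < n" "j \<in> {..n} - {i}" for i j
  proof -
    have "R i j \<ge> 0" unfolding R_def psi_min_def Let_def by (rule Max_ge) auto
    then show ?thesis using False that by (force simp: R_def)
  qed
  have Qn: "Q n = Infinity" using assms(2) by (simp add: block_def)
  \<comment> \<open>Positive separation from infinity excludes the top square.\<close>
  have proper: "proper (Q i)" if "i < n" for i
    using R[of i n] that assms(2) psi_min_top_square unfolding R_def Qn
    by (auto simp: block_def proper_def)
  have proper': "proper (Q i) \<or> Q i = Infinity" if "i \<le> n" for i
    using that proper Qn by (cases "i = n") auto
  define err where "err i = (\<Sum>j\<in>{..n} - {i}. pair_error E (Q i) (R i j) * (delta (Q i))\<^sup>2)" for i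
  have step: "\<exists>v\<in>vertices (Q i). energy E n (z(i := v)) \<le> energy E n z + err i"
    if i: "i < n" and z: "z \<in> dominated_configs n Q" for i z
  proof -
    have zk: "z k \<in> points (Q k)" if "k \<le> n" for k
      using z that by (auto simp: dominated_configs_def)
    have sep: "R i j \<le> norm (inv_stereo p - inv_stereo (z j))" if "j \<in> {..n} - {i}" "p \<in> points (Q i)" for j p
      using psi_min_le_chord[OF proper[OF i] proper'[of j] that(2) zk[of j]] that(1)
      by (simp add: R_def chord_def)
    have "\<exists>v\<in>vertices (Q i). (\<Sum>j\<in>{..n} - {i}. E (norm (inv_stereo v - inv_stereo (z j))))
      \<le> (\<Sum>j\<in>{..n} - {i}. E (norm (inv_stereo (z i) - inv_stereo (z j)))) + err i"
      unfolding err_def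
      by (rule vertex_energy_le[OF assms(3) proper[OF i] zk[of i]]) (use i R[OF i] sep in auto)
    then obtain v where v: "v \<in> vertices (Q i)"
      "(\<Sum>j\<in>{..n} - {i}. E (chord v (z j))) \<le> (\<Sum>j\<in>{..n} - {i}. E (chord (z i) (z j))) + err i"
      unfolding chord_def by blast
    moreover have "energy E n (z(i := v)) \<le> energy E n z + err i"
      using energy_fun_upd[of i n E z v] i v(2) by simp
    ultimately show ?thesis by blast
  qed
  \<comment> \<open>The first k points are moved in turn. Each intermediate configuration remains
    dominated, so the same separation bounds, and hence the same \<open>err i\<close>, hold at every
    step.\<close>
  have vertexify: "\<exists>w\<in>dominated_configs n Q. (\<forall>i<k. w i \<in> vertices (Q i)) \<and>
      energy E n w \<le> energy E n z + (\<Sum>i<k. err i)"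
    if z: "z \<in> dominated_configs n Q" and k: "k \<le> n" for z k
    using k
  proof (induction k)
    case 0
    then show ?case using z by auto
  next
    case (Suc k)
    then obtain w where w: "w \<in> dominated_configs n Q" "\<forall>i<k. w i \<in> vertices (Q i)"
      "energy E n w \<le> energy E n z + (\<Sum>i<k. err i)" by auto
    obtain v where v: "v \<in> vertices (Q k)" "energy E n (w(k := v)) \<le> energy E n w + err k"
      using step[OF _ w(1), of k] Suc.prems by auto
    have "w(k := v) \<in> dominated_configs n Q"
      using w(1) v(1) vertices_subset_points[OF proper'[of k]] Suc.prems
      unfolding dominated_configs_def by (intro PiE_I) (auto simp: PiE_iff extensional_def)
    moreover have "\<forall>i<Suc k. (w(k := v)) i \<in> vertices (Q i)" using w(2) v(1) by (auto simp: less_Suc_eq)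
    moreover have "energy E n (w(k := v)) \<le> energy E n z + (\<Sum>i<Suc k. err i)"
      using v(2) w(3) by (simp only: sum.lessThan_Suc)
    ultimately show ?case by blast
  qed
  have le: "min_vertex_energy E n Q - (\<Sum>i<n. err i) \<le> energy E n z" if z: "z \<in> dominated_configs n Q" for z
  proof -
    obtain w where w: "w \<in> dominated_configs n Q" "\<forall>i<n. w i \<in> vertices (Q i)"
      "energy E n w \<le> energy E n z + (\<Sum>i<n. err i)" using vertexify[OF z, of n] by auto
    \<comment> \<open>Only indices below n were moved; the last point is infinity, its own
      vertex.\<close>
    have "w i \<in> vertices (Q i)" if "i \<le> n" for i
    proof (cases "i = n")
      case True
      have "w n \<in> points (Q n)" using w(1) by (auto simp: dominated_configs_def)
      then show ?thesis using True Qn by (simp add: points_def)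
    qed (use that w(2) in auto)
    then have "w \<in> vertex_configs n Q"
      using w(1) by (auto simp: dominated_configs_def vertex_configs_def PiE_iff)
    moreover have "finite (vertex_configs n Q)" by (simp add: vertex_configs_def finite_PiE)
    ultimately have "min_vertex_energy E n Q \<le> energy E n w"
      unfolding min_vertex_energy_def by (intro Min_le) auto
    then show ?thesis using w(3) by linarith
  qed
  have "dominated_configs n Q \<noteq> {}"
    unfolding dominated_configs_def PiE_eq_empty_iff
    using vertices_subset_points[OF proper'] vertices_nonempty by blast
  then have "min_vertex_energy E n Q - (\<Sum>i<n. err i) \<le> min_energy E n Q"
    unfolding min_energy_def by (rule cINF_greatest) (rule le)
  then have "ERR E n Q \<le> (\<Sum>i<n. err i)" by (simp add: ERR_def)
  also have "ereal (\<Sum>i<n. err i) =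
      (\<Sum>i<n. \<Sum>j\<in>{..n} - {i}. err_eps E (Q i) (Q j) * ereal ((delta (Q i))\<^sup>2))"
    unfolding err_def sum_ereal[symmetric]
  proof (intro sum.cong refl)
    fix i j assume "i \<in> {..<n}" "j \<in> {..n} - {i}"
    then have "psi_min (Q i) (Q j) \<noteq> 0" using False by blast
    then show "ereal (pair_error E (Q i) (R i j) * (delta (Q i))\<^sup>2) =
        err_eps E (Q i) (Q j) * ereal ((delta (Q i))\<^sup>2)"
      by (simp add: err_eps_def pair_error_def R_def Let_def)
  qed
  finally show ?thesis by simp
qed

end
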